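(* Let $\mathcal{P}$ be a homogeneous Poisson process of intensity $1$ on $\mathbb{R}$ and let $\mu$ be any degree distribution (probability measure on the strictly positive integers) whose support includes some odd integer. Then for any factor matching scheme, the number of edges that cross the origin is almost surely infinite.
   Context: Setting. Write $[\mathcal{P}]=\{x\in\mathbb{R}:\mathcal{P}(\{x\})>0\}$ for the point-set of $\mathcal{P}$. Conditionally on $\mathcal{P}$, the points $x\in[\mathcal{P}]$ carry i.i.d. marks $D_x$ with law $\mu$ (the number of stubs at $x$); the resulting marked point process is denoted $(\mathcal{P},\xi)$ with $\xi(\{x\})=D_x$. Matching scheme. A matching scheme for $(\mathcal{P},\xi)$ is a point process $\mathcal{M}$ on the space of unordered pairs of points of $\mathbb{R}$ such that almost surely every pair $(x,y)\in[\mathcal{M}]$ has $x,y\in[\mathcal{P}]$, and in the graph $G$ with vertex set $[\mathcal{P}]$ and edge set $[\mathcal{M}]$ each vertex $x$ has degree exactly $D_x$. All matching schemes are assumed simple (almost surely no self-loops and no multiple edges) and translation-invariant ($\mathcal{M}$ is invariant in law under all translations of $\mathbb{R}$). A translation-invariant matching scheme is a factor if it is a deterministic function of $\mathcal{P}$ and $\xi$, i.e. involves no additional randomness. Crossing. An edge $(x,y)\in[\mathcal{M}]$ with $x<y$ crosses a site $z\in\mathbb{R}$ if $x<z<y$. *)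

theory Defs
  imports "HOL-Probability.Probability" "HOL-Library.Uprod"
begin

text \<open>
  Configurations are locally finite counting measures, i.e. sums of point masses with natural
  multiplicities.  Local finiteness means that every set \<open>K n\<close> has finite measure, where \<open>K\<close> is an
  increasing exhaustion of the underlying space by bounded sets.  The sigma-algebra is the one
  generated by the evaluation maps, as for \<^const>\<open>subprob_algebra\<close>.
\<close>

definition configs :: "'a measure \<Rightarrow> (nat \<Rightarrow> 'a set) \<Rightarrow> 'a measure set" where
  "configs E K = {N. sets N = sets E \<and>
     (\<exists>m :: 'a \<Rightarrow> nat. \<forall>A \<in> sets E. emeasure N A = (\<integral>\<^sup>+ x. of_nat (m x) \<partial>count_space A)) \<and>
     (\<forall>n. emeasure N (K n) < \<infinity>)}"

definition config_algebra :: "'a measure \<Rightarrow> (nat \<Rightarrow> 'a set) \<Rightarrow> 'a measure measure" where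
  "config_algebra E K =
     (SUP A \<in> sets E. vimage_algebra (configs E K) (\<lambda>N. emeasure N A) borel)"

definition point_set :: "'a measure \<Rightarrow> 'a set" where
  "point_set N = {x. emeasure N {x} > 0}"

abbreviation real_configs :: "real measure measure" where
  "real_configs \<equiv> config_algebra borel (\<lambda>n. {- real n .. real n})"

text \<open>The space of unordered pairs carries the quotient Borel structure of the plane.\<close>

definition uprod_borel :: "real uprod measure" where
  "uprod_borel = sigma UNIV {A. {(x, y). Upair x y \<in> A} \<in> sets borel}"

abbreviation uprod_configs :: "real uprod measure measure" where
  "uprod_configs \<equiv> config_algebra uprod_borel (\<lambda>n. {e. set_uprod e \<subseteq> {- real n .. real n}})"

text \<open>
  The explicit probability mass function also covers Lebesgue null sets; \<open>poisson_pmf\<close> is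
  restricted to positive rates.
\<close>

definition poisson_process :: "'w measure \<Rightarrow> real \<Rightarrow> ('w \<Rightarrow> real measure) \<Rightarrow> bool" where
  "poisson_process \<Omega> c P \<longleftrightarrow>
     P \<in> \<Omega> \<rightarrow>\<^sub>M real_configs \<and>
     (\<forall>A \<in> sets borel. emeasure lborel A < \<infinity> \<longrightarrow>
        (\<forall>k :: nat. measure \<Omega> {\<omega> \<in> space \<Omega>. emeasure (P \<omega>) A = of_nat k} =
           (c * measure lborel A) ^ k / fact k * exp (- (c * measure lborel A)))) \<and>
     (\<forall>(n :: nat) A. (\<forall>i<n. A i \<in> sets borel) \<and> disjoint_family_on A {..<n} \<longrightarrow>
        prob_space.indep_vars \<Omega> (\<lambda>_. borel) (\<lambda>i \<omega>. emeasure (P \<omega>) (A i)) {..<n})"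

text \<open>
  Conditionally on \<open>P\<close> the marks \<open>\<xi> {x}\<close>, \<open>x \<in> [P]\<close>, are i.i.d. with law \<open>\<mu>\<close>.  The points carry no
  labels, so this is expressed through points \<open>X 0, \<dots>, X (n - 1)\<close> of \<open>P\<close> selected measurably with
  respect to \<open>P\<close>: wherever these are distinct points of \<open>P\<close>, the conditional joint law of their
  marks given \<open>P\<close> is the \<open>n\<close>-fold product of \<open>\<mu>\<close>.
\<close>

definition iid_marks ::
    "'w measure \<Rightarrow> ('w \<Rightarrow> real measure) \<Rightarrow> nat pmf \<Rightarrow> ('w \<Rightarrow> real measure) \<Rightarrow> bool" where
  "iid_marks \<Omega> P \<mu> \<xi> \<longleftrightarrow>
     \<xi> \<in> \<Omega> \<rightarrow>\<^sub>M real_configs \<and>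
     (AE \<omega> in \<Omega>. point_set (\<xi> \<omega>) \<subseteq> point_set (P \<omega>)) \<and>
     (let \<sigma>P = vimage_algebra (space \<Omega>) P real_configs in
      \<forall>(n :: nat) (X :: nat \<Rightarrow> 'w \<Rightarrow> real) (k :: nat \<Rightarrow> nat).
        (\<forall>i<n. X i \<in> borel_measurable \<sigma>P) \<longrightarrow>
        (AE \<omega> in \<Omega>. inj_on (\<lambda>i. X i \<omega>) {..<n} \<and> (\<forall>i<n. X i \<omega> \<in> point_set (P \<omega>)) \<longrightarrow>
           real_cond_exp \<Omega> \<sigma>P
             (indicator {\<omega>' \<in> space \<Omega>. \<forall>i<n. emeasure (\<xi> \<omega>') {X i \<omega>'} = of_nat (k i)}) \<omega>
           = (\<Prod>i<n. pmf \<mu> (k i))))"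

text \<open>
  The degree counts the incident elements of the edge set \<open>[M]\<close>; this is the graph degree
  because schemes are moreover required to be simple.
\<close>

definition matching_scheme ::
    "'w measure \<Rightarrow> ('w \<Rightarrow> real measure) \<Rightarrow> ('w \<Rightarrow> real measure) \<Rightarrow> ('w \<Rightarrow> real uprod measure) \<Rightarrow> bool"
  where
  "matching_scheme \<Omega> P \<xi> M \<longleftrightarrow>
     M \<in> \<Omega> \<rightarrow>\<^sub>M uprod_configs \<and>
     (AE \<omega> in \<Omega>.
        (\<forall>e \<in> point_set (M \<omega>). set_uprod e \<subseteq> point_set (P \<omega>)) \<and>
        (\<forall>x \<in> point_set (P \<omega>).
           finite {e \<in> point_set (M \<omega>). x \<in> set_uprod e} \<and>
           emeasure (\<xi> \<omega>) {x} = of_nat (card {e \<in> point_set (M \<omega>). x \<in> set_uprod e})))"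

definition simple_scheme :: "'w measure \<Rightarrow> ('w \<Rightarrow> real uprod measure) \<Rightarrow> bool" where
  "simple_scheme \<Omega> M \<longleftrightarrow>
     (AE \<omega> in \<Omega>. \<forall>e \<in> point_set (M \<omega>). proper_uprod e \<and> emeasure (M \<omega>) {e} = 1)"

definition translation_invariant :: "'w measure \<Rightarrow> ('w \<Rightarrow> real uprod measure) \<Rightarrow> bool" where
  "translation_invariant \<Omega> M \<longleftrightarrow>
     (\<forall>t. distr \<Omega> uprod_configs (\<lambda>\<omega>. distr (M \<omega>) uprod_borel (map_uprod (\<lambda>x. x + t)))
          = distr \<Omega> uprod_configs M)"

definition is_factor ::
    "'w measure \<Rightarrow> ('w \<Rightarrow> real measure) \<Rightarrow> ('w \<Rightarrow> real measure) \<Rightarrow> ('w \<Rightarrow> real uprod measure) \<Rightarrow> bool"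
  where
  "is_factor \<Omega> P \<xi> M \<longleftrightarrow>
     (\<exists>F \<in> real_configs \<Otimes>\<^sub>M real_configs \<rightarrow>\<^sub>M uprod_configs. AE \<omega> in \<Omega>. M \<omega> = F (P \<omega>, \<xi> \<omega>))"

definition factor_matching_scheme ::
    "'w measure \<Rightarrow> ('w \<Rightarrow> real measure) \<Rightarrow> ('w \<Rightarrow> real measure) \<Rightarrow> ('w \<Rightarrow> real uprod measure) \<Rightarrow> bool"
  where
  "factor_matching_scheme \<Omega> P \<xi> M \<longleftrightarrow>
     matching_scheme \<Omega> P \<xi> M \<and> simple_scheme \<Omega> M \<and> translation_invariant \<Omega> M \<and> is_factor \<Omega> P \<xi> M"

definition crosses :: "real uprod \<Rightarrow> real \<Rightarrow> bool" where
  "crosses e z \<longleftrightarrow> (\<exists>x y. e = Upair x y \<and> x < z \<and> z < y)"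

end

theory Submission
  imports Defs
begin

text \<open>
  The proof is a parity argument. Call \<open>e = {x, y}\<close> an edge across \<open>z\<close> if \<open>x \<le> z < y\<close>, and let \<open>Y z\<close> be
  \<open>1\<close> or \<open>-1\<close> according to the parity of the number of edges across \<open>z\<close>, and \<open>0\<close> if there are infinitely
  many. An edge contributes to the difference between the numbers at \<open>s < t\<close>, modulo 2, the number of its
  endpoints in \<open>{s<..t}\<close>; as the degree of a point is its mark,
  \<open>Y s * Y t * (-1) ^ \<xi> {s<..t} = \<bar>Y s\<bar>\<close> almost surely (\<open>crossing_sign_product\<close>). In particular the
  expectation of \<open>Y 0 * Y t * (-1) ^ \<xi> {0<..t}\<close> is the probability that finitely many edges cross \<open>0\<close>,
  for every \<open>t \<ge> 0\<close>. It remains to show that this expectation tends to \<open>0\<close>.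

  The factor property says that \<open>Y 0\<close> is a function of \<open>(P, \<xi>)\<close>. It is therefore approximated in mean by a
  function of the numbers of stubs in finitely many intervals near \<open>0\<close> (\<open>factor_sign_approx\<close>), and by
  translation invariance \<open>Y t\<close> is approximated equally well by the same function of the intervals
  near \<open>t\<close> (\<open>expectation_translate\<close>). After this replacement, \<open>(-1) ^ \<xi> {0<..t}\<close> splits into a
  part near \<open>0\<close>, a part near \<open>t\<close> and a long middle part that is independent of everything else. The
  process \<open>\<xi>\<close> has independent stationary increments (\<open>distr_counts\<close>), so the middle part has
  expectation \<open>\<rho> ^ n\<close> (\<open>decorrelation\<close>), where \<open>n\<close> is proportional to its length and \<open>\<rho>\<close> is the expected sign of one
  increment. An increment is even with positive probability, when there is no point, and odd with positive
  probability, when there is one point with an odd mark; hence \<open>\<bar>\<rho>\<bar> < 1\<close> (\<open>expectation_sign_less_1\<close>).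

  Two reductions make this work at the level of laws. Marks are positive, so that \<open>P\<close> has the same
  points as \<open>\<xi>\<close> and its counts can be recovered from those of \<open>\<xi>\<close> alone; thus everything that depends
  measurably on \<open>(P, \<xi>)\<close> is approximated by counts of \<open>\<xi>\<close>. Moreover \<open>\<xi>\<close> is the degree process of the
  edge set \<open>M\<close> (\<open>matching_stubs\<close>), so that invariance of the law of \<open>M\<close> yields joint invariance of the
  counts of \<open>\<xi>\<close> and the crossing parities.
\<close>

section \<open>Configurations as counting measures\<close>

text \<open>
  A total natural-number version of the measure of a set. It agrees with the measure where a configuration
  is finite; infinite measure is sent to \<open>0\<close>.
\<close>

definition cnt :: "'a measure \<Rightarrow> 'a set \<Rightarrow> nat" where
  "cnt N A = nat \<lfloor>enn2real (emeasure N A)\<rfloor>"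

lemma cnt_eq: "emeasure N A = of_nat k \<Longrightarrow> cnt N A = k"
  by (simp add: cnt_def)

lemma measurable_cnt [measurable (raw)]:
  assumes "(\<lambda>\<omega>. emeasure (f \<omega>) A) \<in> borel_measurable \<Omega>"
  shows "(\<lambda>\<omega>. cnt (f \<omega>) A) \<in> \<Omega> \<rightarrow>\<^sub>M count_space UNIV"
  unfolding cnt_def using assms by measurable

lemma space_config_algebra [simp]: "space (config_algebra E K) = configs E K"
  by (auto simp: config_algebra_def space_Sup_eq_UN intro: exI[of _ "{}"])

lemma measurable_config_algebra:
  assumes "\<And>\<omega>. \<omega> \<in> space \<Omega> \<Longrightarrow> f \<omega> \<in> configs E K"
    and "\<And>A. A \<in> sets E \<Longrightarrow> (\<lambda>\<omega>. emeasure (f \<omega>) A) \<in> borel_measurable \<Omega>"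
  shows "f \<in> \<Omega> \<rightarrow>\<^sub>M config_algebra E K"
  unfolding config_algebra_def using assms
  by (intro measurable_Sup2) (auto intro!: measurable_vimage_algebra2)

lemma measurable_config_eval:
  assumes "A \<in> sets E"
  shows "(\<lambda>N. emeasure N A) \<in> borel_measurable (config_algebra E K)"
  unfolding config_algebra_def using assms
  by (auto intro!: measurable_Sup1 measurable_vimage_algebra1)

lemma measurable_eval_config:
  assumes "f \<in> \<Omega> \<rightarrow>\<^sub>M config_algebra E K" and "A \<in> sets E"
  shows "(\<lambda>\<omega>. emeasure (f \<omega>) A) \<in> borel_measurable \<Omega>"
  using measurable_compose[OF assms(1) measurable_config_eval[OF assms(2)]] .

lemma configs_emeasure_singleton:
  assumes N: "N \<in> configs E K" and x: "{x} \<in> sets E"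
  shows "emeasure N {x} = of_nat (cnt N {x})"
proof -
  obtain m :: "'a \<Rightarrow> nat"
    where "\<forall>A \<in> sets E. emeasure N A = (\<integral>\<^sup>+ x. of_nat (m x) \<partial>count_space A)"
    using N by (auto simp: configs_def)
  then have "emeasure N {x} = of_nat (m x)"
    using x by (simp add: nn_integral_count_space_finite)
  then show ?thesis using cnt_eq by metis
qed

lemma configs_emeasure:
  assumes N: "N \<in> configs E K" and E: "\<And>x. {x} \<in> sets E" and A: "A \<in> sets E"
  shows "emeasure N A = (\<integral>\<^sup>+ x. of_nat (cnt N {x}) \<partial>count_space A)"
proof -
  obtain m :: "'a \<Rightarrow> nat"
    where m: "\<forall>A \<in> sets E. emeasure N A = (\<integral>\<^sup>+ x. of_nat (m x) \<partial>count_space A)"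
    using N by (auto simp: configs_def)
  have "emeasure N {x} = of_nat (m x)" for x
    using E m by (simp add: nn_integral_count_space_finite)
  then have "cnt N {x} = m x" for x using cnt_eq by metis
  then show ?thesis using m A by simp
qed

lemma configs_point_set:
  assumes "N \<in> configs E K" and "\<And>x. {x} \<in> sets E"
  shows "x \<in> point_set N \<longleftrightarrow> 0 < cnt N {x}"
  using configs_emeasure_singleton[OF assms(1) assms(2)[of x]] by (simp add: point_set_def)

text \<open>
  A sum of natural numbers over an arbitrary set is finite only if all but finitely many terms vanish.
\<close>

lemma configs_finite:
  assumes N: "N \<in> configs E K" and E: "\<And>x. {x} \<in> sets E" and A: "A \<in> sets E"
    and fin: "emeasure N A < \<infinity>"
  shows configs_finite_points: "finite (point_set N \<inter> A)"
    and configs_emeasure_sum: "emeasure N A = of_nat (\<Sum>x\<in>point_set N \<inter> A. cnt N {x})"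
    and configs_cnt_sum: "cnt N A = (\<Sum>x\<in>point_set N \<inter> A. cnt N {x})"
proof -
  let ?f = "\<lambda>x. of_nat (cnt N {x}) :: ennreal"
  have pts: "point_set N \<inter> A = {a \<in> A. 0 < ?f a}"
    using configs_point_set[OF N E] by auto
  have "emeasure (count_space A) (point_set N \<inter> A) = (\<integral>\<^sup>+ x. indicator (point_set N \<inter> A) x \<partial>count_space A)"
    by simp
  also have "\<dots> \<le> (\<integral>\<^sup>+ x. ?f x \<partial>count_space A)"
  proof (rule nn_integral_mono)
    fix x
    show "indicator (point_set N \<inter> A) x \<le> ?f x"
      using configs_point_set[OF N E, of x] of_nat_mono[of 1 "cnt N {x}", where 'a = ennreal]
      by (cases "x \<in> point_set N \<inter> A") auto
  qed
  also have "\<dots> < \<infinity>" using fin configs_emeasure[OF N E A] by simp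
  finally show f: "finite (point_set N \<inter> A)"
    by (auto simp: emeasure_count_space split: if_splits)
  then have "(\<integral>\<^sup>+ x. ?f x \<partial>count_space A) = (\<Sum>a | a \<in> A \<and> 0 < ?f a. ?f a)"
    unfolding pts by (rule nn_integral_count_space)
  then show e: "emeasure N A = of_nat (\<Sum>x\<in>point_set N \<inter> A. cnt N {x})"
    unfolding pts configs_emeasure[OF N E A] by simp
  show "cnt N A = (\<Sum>x\<in>point_set N \<inter> A. cnt N {x})" by (rule cnt_eq[OF e])
qed

lemma configs_emeasure_cnt:
  assumes "N \<in> configs E K" and "\<And>x. {x} \<in> sets E" and "A \<in> sets E" and "emeasure N A < \<infinity>"
  shows "emeasure N A = of_nat (cnt N A)"
  using configs_emeasure_sum[OF assms] configs_cnt_sum[OF assms] by simp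

lemma configs_simple_emeasure:
  assumes N: "N \<in> configs E K" and E: "\<And>x. {x} \<in> sets E" and A: "A \<in> sets E"
    and s: "\<And>x. x \<in> A \<Longrightarrow> cnt N {x} \<le> 1"
  shows "emeasure N A = emeasure (count_space UNIV) (point_set N \<inter> A)"
proof -
  have *: "cnt N {x} = (if x \<in> point_set N then 1 else 0)" if "x \<in> A" for x
    using s[OF that] configs_point_set[OF N E, of x] by auto
  have "emeasure N A = (\<integral>\<^sup>+ x. indicator (point_set N \<inter> A) x \<partial>count_space A)"
    unfolding configs_emeasure[OF N E A]
    by (intro nn_integral_cong) (auto simp: * indicator_def)
  then show ?thesis by (simp add: emeasure_count_space)
qed

abbreviation window :: "nat \<Rightarrow> real set" where "window \<equiv> \<lambda>n. {- real n .. real n}"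

lemma configs_mono:
  assumes N: "N \<in> configs E K" and "A \<subseteq> K n" "K n \<in> sets E"
  shows "emeasure N A < \<infinity>"
proof -
  have "emeasure N A \<le> emeasure N (K n)"
    using assms by (intro emeasure_mono) (auto simp: configs_def)
  also have "\<dots> < \<infinity>" using N by (auto simp: configs_def)
  finally show ?thesis .
qed

lemma real_configs_bounded:
  assumes N: "N \<in> configs borel window" and b: "bounded A"
  shows "emeasure N A < \<infinity>"
proof -
  obtain c where c: "\<And>x. x \<in> A \<Longrightarrow> \<bar>x\<bar> \<le> c" using b by (auto simp: bounded_iff)
  obtain n where n: "c \<le> real n" using real_arch_simple by blast
  have "A \<subseteq> window n" using c n by (force simp: abs_le_iff)
  then show ?thesis using configs_mono[OF N] by simp
qed

lemma bounded_Ioc [simp]: "bounded {a<..b::real}"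
  by (rule bounded_subset[of "{a..b}"]) auto

lemma real_configs_Ioc:
  assumes N: "N \<in> configs borel window"
  shows "emeasure N {a<..b} = of_nat (cnt N {a<..b})"
    and "cnt N {a<..b} = (\<Sum>x\<in>point_set N \<inter> {a<..b}. cnt N {x})"
    and "finite (point_set N \<inter> {a<..b})"
  by (rule configs_emeasure_cnt[OF N _ _ real_configs_bounded[OF N]] configs_cnt_sum[OF N _ _ real_configs_bounded[OF N]]
      configs_finite_points[OF N _ _ real_configs_bounded[OF N]]; simp)+

lemma real_configs_singleton:
  assumes N: "N \<in> configs borel window"
  shows "emeasure N {x} = of_nat (cnt N {x})" "x \<in> point_set N \<longleftrightarrow> 0 < cnt N {x}"
  using configs_emeasure_singleton[OF N] configs_point_set[OF N] by auto

lemma real_configs_Ioc_add: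
  assumes N: "N \<in> configs borel window" and "a \<le> b" "b \<le> c"
  shows "cnt N {a<..c} = cnt N {a<..b} + cnt N {b<..c}"
proof -
  have "point_set N \<inter> {a<..c} = (point_set N \<inter> {a<..b}) \<union> (point_set N \<inter> {b<..c})" using assms by auto
  then show ?thesis unfolding real_configs_Ioc(2)[OF N]
    by (simp, subst sum.union_disjoint) (auto simp: real_configs_Ioc(3)[OF N])
qed

lemma cnt_Ioc_mono:
  assumes N: "N \<in> configs borel window" and "b \<le> c"
  shows "cnt N {a<..b} \<le> cnt N {a<..c}"
proof (cases "a \<le> b")
  case True
  then show ?thesis using real_configs_Ioc_add[OF N True assms(2)] by simp
next
  case False
  then show ?thesis by (simp add: cnt_def)
qed

lemma sets_real_configs [simp]: "N \<in> configs E window \<Longrightarrow> sets N = sets E"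
  by (auto simp: configs_def)

text \<open>
  Intervals with rational endpoints form an intersection-stable generator of the Borel sets. Inside a
  bounded window all measures are finite, so the sets with measurable evaluation form a Dynkin system there;
  the windows then exhaust the line.
\<close>

lemma measurable_real_configs_rational:
  assumes c: "\<And>\<omega>. \<omega> \<in> space \<Omega> \<Longrightarrow> f \<omega> \<in> configs borel window"
    and m: "\<And>a b. a \<in> \<rat> \<Longrightarrow> b \<in> \<rat> \<Longrightarrow> (\<lambda>\<omega>. emeasure (f \<omega>) {a<..b}) \<in> borel_measurable \<Omega>"
  shows "f \<in> \<Omega> \<rightarrow>\<^sub>M real_configs"
proof (rule measurable_config_algebra[OF c])
  fix A :: "real set" assume A: "A \<in> sets borel"
  let ?G = "(\<lambda>(a, b). {a<..b::real}) ` (\<rat> \<times> \<rat>)"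
  have Int: "Int_stable ?G"
  proof (rule Int_stableI)
    fix A B assume "A \<in> ?G" "B \<in> ?G"
    then obtain a b c d where "A = {a<..b}" "B = {c<..d}" "a \<in> \<rat>" "b \<in> \<rat>" "c \<in> \<rat>" "d \<in> \<rat>" by auto
    moreover have "{a<..b} \<inter> {c<..d} = {max a c<..min b d}" by auto
    moreover have "max a c \<in> \<rat>" "min b d \<in> \<rat>" using calculation by (auto simp: max_def min_def)
    ultimately show "A \<inter> B \<in> ?G" by (auto intro!: image_eqI[of _ _ "(max a c, min b d)"])
  qed
  have gen: "sets borel = sigma_sets UNIV ?G"
  proof -
    have "(borel :: real measure) = sigma UNIV ?G"
    proof (rule borel_eq_sigmaI1[OF borel_eq_box[where 'a = real, unfolded box_real]])
      fix B :: "real set" assume "B \<in> range (\<lambda>(a, b). {a<..<b})"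
      then obtain a b where B: "B = {a<..<b}" by auto
      have "B = (\<Union>(p, q)\<in>{(p, q) \<in> \<rat> \<times> \<rat>. a < p \<and> q < b}. {p<..q})" 
      proof (rule set_eqI)
        fix x
        show "x \<in> B \<longleftrightarrow> x \<in> (\<Union>(p, q)\<in>{(p, q) \<in> \<rat> \<times> \<rat>. a < p \<and> q < b}. {p<..q})"
        proof
          assume "x \<in> B"
          then obtain p q where "p \<in> \<rat>" "a < p" "p < x" "q \<in> \<rat>" "x < q" "q < b"
            using Rats_dense_in_real[of a x] Rats_dense_in_real[of x b] B by auto
          then show "x \<in> (\<Union>(p, q)\<in>{(p, q) \<in> \<rat> \<times> \<rat>. a < p \<and> q < b}. {p<..q})" by force
        qed (auto simp: B)
      qed
      also have "\<dots> \<in> sets (sigma UNIV ?G)"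
      proof (rule sets.countable_UN'')
        show "countable {(p, q) \<in> \<rat> \<times> \<rat>. a < p \<and> q < b}"
          by (rule countable_subset[OF _ countable_SIGMA[OF countable_rat countable_rat]]) auto
        fix z assume "z \<in> {(p, q) \<in> \<rat> \<times> \<rat>. a < p \<and> q < b}"
        then show "(case z of (p, q) \<Rightarrow> {p<..q}) \<in> sets (sigma UNIV ?G)" by auto
      qed
      finally show "B \<in> sets (sigma UNIV ?G)" .
    qed auto
    from arg_cong[OF this, of sets] show ?thesis by (simp only: sets_measure_of Pow_UNIV subset_UNIV)
  qed
  have cl: "?G \<subseteq> Pow UNIV" by simp
  have step: "(\<lambda>\<omega>. emeasure (f \<omega>) (A \<inter> {- real n<..real n})) \<in> borel_measurable \<Omega>" for n
    using A[unfolded gen]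
  proof (induct rule: sigma_sets_induct_disjoint[OF Int cl, consumes 1, case_names basic empty compl union])
    case (basic A)
    then obtain a b where A: "A = {a<..b}" "a \<in> \<rat>" "b \<in> \<rat>" by auto
    have "A \<inter> {- real n<..real n} = {max a (- real n)<..min b (real n)}" by (auto simp: A)
    moreover have "max a (- real n) \<in> \<rat>" "min b (real n) \<in> \<rat>" using A by (auto simp: max_def min_def)
    ultimately show ?case using m by simp
  next
    case (compl A)
    have *: "A \<in> sets borel" using compl gen by simp
    have "emeasure (f \<omega>) ((UNIV - A) \<inter> {- real n<..real n}) =
       emeasure (f \<omega>) {- real n<..real n} - emeasure (f \<omega>) (A \<inter> {- real n<..real n})" if "\<omega> \<in> space \<Omega>" for \<omega>
    proof -
      have "(UNIV - A) \<inter> {- real n<..real n} = {- real n<..real n} - (A \<inter> {- real n<..real n})" by auto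
      moreover have "emeasure (f \<omega>) (A \<inter> {- real n<..real n}) \<noteq> \<infinity>"
        using real_configs_bounded[OF c[OF that] bounded_subset[OF bounded_Ioc Int_lower2], of A "- real n" "real n"]
        by (simp add: less_top)
      ultimately show ?thesis
        using * c[OF that] by (simp add: emeasure_Diff)
    qed
    moreover have "(\<lambda>\<omega>. emeasure (f \<omega>) {- real n<..real n} - emeasure (f \<omega>) (A \<inter> {- real n<..real n})) \<in> borel_measurable \<Omega>"
      using m[of "- real n" "real n"] compl by measurable
    ultimately show ?case by (simp cong: measurable_cong)
  next
    case (union A)
    have *: "A i \<in> sets borel" for i using union gen by auto
    have "emeasure (f \<omega>) (\<Union> (range A) \<inter> {- real n<..real n}) = (\<Sum>i. emeasure (f \<omega>) (A i \<inter> {- real n<..real n}))" if "\<omega> \<in> space \<Omega>" for \<omega>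
    proof -
      have "(\<Sum>i. emeasure (f \<omega>) (A i \<inter> {- real n<..real n})) = emeasure (f \<omega>) (\<Union>i. A i \<inter> {- real n<..real n})"
        using union * c[OF that] by (intro suminf_emeasure) (auto simp: disjoint_family_on_def)
      then show ?thesis by (simp add: SUP_UN_eq)
    qed
    then show ?case using union by (simp cong: measurable_cong)
  qed auto
  have "emeasure (f \<omega>) A = (SUP n. emeasure (f \<omega>) (A \<inter> {- real n<..real n}))" if "\<omega> \<in> space \<Omega>" for \<omega>
  proof -
    have "(\<Union>n. A \<inter> {- real n<..real n}) = A"
    proof -
      have "\<exists>n. - real n < x \<and> x \<le> real n" for x :: real
        using reals_Archimedean2[of "\<bar>x\<bar>"] by (metis abs_less_iff less_imp_le minus_less_iff)
      then show ?thesis by auto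
    qed
    moreover have "incseq (\<lambda>n. A \<inter> {- real n<..real n})" by (auto simp: incseq_def)
    moreover have "range (\<lambda>n. A \<inter> {- real n<..real n}) \<subseteq> sets (f \<omega>)" using A c[OF that] by auto
    ultimately show ?thesis using SUP_emeasure_incseq by metis
  qed
  then show "(\<lambda>\<omega>. emeasure (f \<omega>) A) \<in> borel_measurable \<Omega>" using step by (simp cong: measurable_cong)
qed

lemma measurable_cnt_Ioc:
  "(\<lambda>N. cnt N {a<..b::real}) \<in> real_configs \<rightarrow>\<^sub>M count_space UNIV"
  by (rule measurable_cnt[OF measurable_config_eval]) simp

text \<open>
  By local finiteness a small interval around \<open>x\<close> contains no point other than \<open>x\<close>. Writing an atom as a
  countable infimum makes its mass measurable also at a random location.
\<close>

lemma emeasure_singleton_eq_INF: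
  assumes N: "N \<in> configs borel window"
  shows "emeasure N {x} = (INF (p, q)\<in>\<rat> \<times> \<rat>. if p < x \<and> x \<le> q then emeasure N {p<..q} else \<infinity>)"
proof (rule antisym)
  show "emeasure N {x} \<le> (INF (p, q)\<in>\<rat> \<times> \<rat>. if p < x \<and> x \<le> q then emeasure N {p<..q} else \<infinity>)"
  proof (rule INF_greatest)
    fix z :: "real \<times> real"
    obtain p q where z: "z = (p, q)" by force
    have "emeasure N {x} \<le> emeasure N {p<..q}" if "p < x" "x \<le> q"
      using N that by (intro emeasure_mono) auto
    then show "emeasure N {x} \<le> (case z of (p, q) \<Rightarrow> if p < x \<and> x \<le> q then emeasure N {p<..q} else \<infinity>)"
      by (simp add: z)
  qed
  obtain d where d: "d > 0" "\<And>y. y \<in> point_set N \<inter> {x-1<..x+1} \<Longrightarrow> y \<noteq> x \<Longrightarrow> d \<le> dist x y"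
    using finite_set_avoid[OF real_configs_Ioc(3)[OF N], of "x - 1" "x + 1" x] by blast
  obtain p where p: "p \<in> \<rat>" "max (x - d) (x - 1) < p" "p < x"
    using Rats_dense_in_real[of "max (x - d) (x - 1)" x] d by auto
  obtain q where q: "q \<in> \<rat>" "x < q" "q < min (x + d) (x + 1)"
    using Rats_dense_in_real[of x "min (x + d) (x + 1)"] d by auto
  have "point_set N \<inter> {p<..q} \<subseteq> {x}"
  proof
    fix y assume y: "y \<in> point_set N \<inter> {p<..q}"
    then have "y \<in> point_set N \<inter> {x-1<..x+1}" using p q by auto
    moreover have "dist x y < d" using y p q by (auto simp: dist_real_def abs_less_iff)
    ultimately show "y \<in> {x}" using d(2)[of y] by force
  qed
  then have "(\<Sum>y\<in>point_set N \<inter> {p<..q}. cnt N {y}) \<le> (\<Sum>y\<in>{x}. cnt N {y})"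
    by (intro sum_mono2) auto
  then have "cnt N {p<..q} \<le> cnt N {x}" unfolding real_configs_Ioc(2)[OF N] by simp
  then have "emeasure N {p<..q} \<le> emeasure N {x}"
    unfolding real_configs_Ioc(1)[OF N] real_configs_singleton(1)[OF N] by simp
  then have "(case (p, q) of (p, q) \<Rightarrow> if p < x \<and> x \<le> q then emeasure N {p<..q} else \<infinity>) \<le> emeasure N {x}"
    using p q by simp
  then show "(INF (p, q)\<in>\<rat> \<times> \<rat>. if p < x \<and> x \<le> q then emeasure N {p<..q} else \<infinity>) \<le> emeasure N {x}"
    using p q by (intro INF_lower2[of "(p, q)"]) auto
qed

lemma measurable_emeasure_random_point:
  assumes f: "f \<in> \<Omega> \<rightarrow>\<^sub>M real_configs" and X: "X \<in> borel_measurable \<Omega>"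
  shows "(\<lambda>\<omega>. emeasure (f \<omega>) {X \<omega>}) \<in> borel_measurable \<Omega>"
proof -
  have "f \<omega> \<in> configs borel window" if "\<omega> \<in> space \<Omega>" for \<omega>
    using measurable_space[OF f that] by simp
  then have "(\<lambda>\<omega>. emeasure (f \<omega>) {X \<omega>}) \<in> borel_measurable \<Omega> \<longleftrightarrow>
    (\<lambda>\<omega>. INF z\<in>\<rat> \<times> \<rat>. if fst z < X \<omega> \<and> X \<omega> \<le> snd z then emeasure (f \<omega>) {fst z<..snd z} else \<infinity>) \<in> borel_measurable \<Omega>"
    by (intro measurable_cong) (simp add: emeasure_singleton_eq_INF case_prod_beta)
  moreover have "\<dots>"
  proof (rule borel_measurable_INF)
    show "countable ((\<rat> :: real set) \<times> (\<rat> :: real set))" using countable_rat by auto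
    fix z :: "real \<times> real"
    have [measurable]: "(\<lambda>\<omega>. emeasure (f \<omega>) {fst z<..snd z}) \<in> borel_measurable \<Omega>"
      by (rule measurable_eval_config[OF f]) simp
    show "(\<lambda>\<omega>. if fst z < X \<omega> \<and> X \<omega> \<le> snd z then emeasure (f \<omega>) {fst z<..snd z} else \<infinity>) \<in> borel_measurable \<Omega>"
      using X by measurable
  qed
  ultimately show ?thesis by blast
qed

text \<open>
  The counts of a simple configuration can be computed recursively from which intervals are hit by a
  configuration \<open>R\<close> with the same points: the rational number \<open>r\<close> separates the rightmost point of
  \<open>{a<..b}\<close> from the other ones.
\<close>

lemma Suc_le_cnt_iff:
  assumes N: "N \<in> configs borel window" and R: "R \<in> configs borel window" and s: "\<forall>x. cnt N {x} \<le> 1"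
    and eq: "point_set N = point_set R"
  shows "Suc k \<le> cnt N {a<..b} \<longleftrightarrow> (\<exists>r\<in>\<rat>. a < r \<and> r < b \<and> k \<le> cnt N {a<..r} \<and> 1 \<le> cnt R {r<..b})"
proof
  assume L: "Suc k \<le> cnt N {a<..b}"
  define S where "S = point_set N \<inter> {a<..b}"
  have fin: "finite S" unfolding S_def by (rule real_configs_Ioc(3)[OF N])
  have sum: "cnt N {a<..b} = (\<Sum>x\<in>S. cnt N {x})" unfolding S_def by (rule real_configs_Ioc(2)[OF N])
  then have "S \<noteq> {}" using L by auto
  define x where "x = Max S"
  have x: "x \<in> S" unfolding x_def using fin \<open>S \<noteq> {}\<close> by (rule Max_in)
  \<comment> \<open>The last point before \<open>x\<close>, or \<open>a\<close> if there is none.\<close>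
  define y where "y = Max (insert a (S - {x}))"
  have "y < x"
    unfolding y_def using fin x by (subst Max_less_iff) (auto simp: S_def x_def order.not_eq_order_implies_strict)
  then obtain r where r: "r \<in> \<rat>" "y < r" "r < x" using Rats_dense_in_real by blast
  have y: "a \<le> y" "\<And>z. z \<in> S \<Longrightarrow> z \<noteq> x \<Longrightarrow> z \<le> y" unfolding y_def using fin by (auto intro!: Max_ge)
  have "point_set N \<inter> {a<..r} = S - {x}"
    using y r x by (auto simp: S_def) (metis greaterThanAtMost_iff Int_iff S_def less_le_trans not_le order.strict_trans1 less_imp_le)
  then have "cnt N {a<..r} = (\<Sum>z\<in>S - {x}. cnt N {z})" unfolding real_configs_Ioc(2)[OF N] by simp
  moreover have "(\<Sum>z\<in>S. cnt N {z}) = cnt N {x} + (\<Sum>z\<in>S - {x}. cnt N {z})" by (rule sum.remove[OF fin x])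
  ultimately have "k \<le> cnt N {a<..r}" using L sum s[rule_format, of x] by linarith
  moreover have "1 \<le> cnt R {r<..b}"
  proof -
    have xR: "x \<in> point_set R \<inter> {r<..b}" using x r eq by (auto simp: S_def)
    from xR have "cnt R {x} \<le> (\<Sum>x\<in>point_set R \<inter> {r<..b}. cnt R {x})"
      by (intro member_le_sum real_configs_Ioc(3)[OF R]) auto
    moreover have "0 < cnt R {x}" using xR real_configs_singleton(2)[OF R] by blast
    ultimately show ?thesis unfolding real_configs_Ioc(2)[OF R] by linarith
  qed
  ultimately show "\<exists>r\<in>\<rat>. a < r \<and> r < b \<and> k \<le> cnt N {a<..r} \<and> 1 \<le> cnt R {r<..b}"
    using r y x by (intro bexI[of _ r]) (auto simp: S_def)
next
  assume "\<exists>r\<in>\<rat>. a < r \<and> r < b \<and> k \<le> cnt N {a<..r} \<and> 1 \<le> cnt R {r<..b}"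
  then obtain r where r: "a < r" "r < b" "k \<le> cnt N {a<..r}" "1 \<le> cnt R {r<..b}" by auto
  have "point_set R \<inter> {r<..b} \<noteq> {}" using r(4) unfolding real_configs_Ioc(2)[OF R] by auto
  then obtain x where x: "x \<in> point_set N \<inter> {r<..b}" unfolding eq by blast
  then have "cnt N {x} \<le> cnt N {r<..b}" unfolding real_configs_Ioc(2)[OF N]
    by (intro member_le_sum real_configs_Ioc(3)[OF N]) auto
  moreover have "0 < cnt N {x}" using x real_configs_singleton(2)[OF N] by blast
  ultimately show "Suc k \<le> cnt N {a<..b}" using r real_configs_Ioc_add[OF N, of a r b] by simp
qed

section \<open>Ordered enumeration of the points of an interval\<close>

lemma nth_le_iff_card:
  fixes xs :: "real list"
  assumes xs: "sorted xs" "distinct xs" and j: "j < length xs"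
  shows "xs ! j \<le> x \<longleftrightarrow> j < card {y \<in> set xs. y \<le> x}"
proof
  assume "xs ! j \<le> x"
  then have "(!) xs ` {..j} \<subseteq> {y \<in> set xs. y \<le> x}"
    using xs j by (auto intro: order.trans[OF sorted_nth_mono])
  then have "card ((!) xs ` {..j}) \<le> card {y \<in> set xs. y \<le> x}"
    by (intro card_mono) auto
  moreover have "card ((!) xs ` {..j}) = Suc j"
    using xs j by (subst card_image) (auto simp: inj_on_def nth_eq_iff_index_eq)
  ultimately show "j < card {y \<in> set xs. y \<le> x}"
    by simp
next
  assume *: "j < card {y \<in> set xs. y \<le> x}"
  show "xs ! j \<le> x"
  proof (rule ccontr)
    assume "\<not> xs ! j \<le> x"
    then have "{y \<in> set xs. y \<le> x} \<subseteq> (!) xs ` {..<j}"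
    proof (intro subsetI)
      fix y assume n: "\<not> xs ! j \<le> x" and y: "y \<in> {y \<in> set xs. y \<le> x}"
      then obtain i where i: "i < length xs" "y = xs ! i" by (auto simp: in_set_conv_nth)
      have "i < j" using sorted_nth_mono[OF xs(1), of j i] n y i by force
      then show "y \<in> (!) xs ` {..<j}" using i by auto
    qed
    then have "card {y \<in> set xs. y \<le> x} \<le> card ((!) xs ` {..<j})" by (intro card_mono) auto
    also have "\<dots> \<le> j" using card_image_le[of "{..<j}" "(!) xs"] by simp
    finally show False using * by simp
  qed
qed

text \<open>
  The point number \<open>j\<close> to the right of \<open>a\<close>, counted from \<open>0\<close>. Inserting \<open>b\<close> keeps the set nonempty, so that
  the infimum is meaningful and measurable for every configuration.
\<close>

definition nth_point :: "real \<Rightarrow> real \<Rightarrow> nat \<Rightarrow> real measure \<Rightarrow> real" where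
  "nth_point a b j N = Inf (insert b {x. a < x \<and> j < cnt N {a<..x}})"

lemma measurable_nth_point:
  assumes "a \<le> b"
  shows "nth_point a b j \<in> borel_measurable real_configs"
  unfolding borel_measurable_iff_less
proof (rule allI)
  fix q
  note [measurable] = measurable_cnt_Ioc
  have "{N \<in> space real_configs. nth_point a b j N < q} =
    {N \<in> space real_configs. b < q \<or> (\<exists>r\<in>\<rat>. a < r \<and> r < q \<and> j < cnt N {a<..r})}"
  proof (intro Collect_cong conj_cong refl)
    fix N assume "N \<in> space real_configs"
    then have N: "N \<in> configs borel window" by simp
    let ?S = "{x. a < x \<and> j < cnt N {a<..x}}"
    have "bdd_below (insert b ?S)" using assms by (auto intro!: bdd_belowI[of _ a])
    then have "nth_point a b j N < q \<longleftrightarrow> (\<exists>x\<in>insert b ?S. x < q)"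
      unfolding nth_point_def by (intro cInf_less_iff) auto
    also have "\<dots> \<longleftrightarrow> b < q \<or> (\<exists>r\<in>\<rat>. a < r \<and> r < q \<and> j < cnt N {a<..r})"
    proof -
      have "\<exists>r\<in>\<rat>. a < r \<and> r < q \<and> j < cnt N {a<..r}" if x: "a < x" "j < cnt N {a<..x}" "x < q" for x
      proof -
        obtain r where "r \<in> \<rat>" "x < r" "r < q" using x Rats_dense_in_real by blast
        then show ?thesis using x cnt_Ioc_mono[OF N, of x r a] by (intro bexI[of _ r]) auto
      qed
      then show ?thesis by blast
    qed
    finally show "nth_point a b j N < q \<longleftrightarrow> b < q \<or> (\<exists>r\<in>\<rat>. a < r \<and> r < q \<and> j < cnt N {a<..r})" .
  qed
  also have "\<dots> \<in> sets real_configs"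
    using countable_rat by measurable
  finally show "{N \<in> space real_configs. nth_point a b j N < q} \<in> sets real_configs" .
qed

text \<open>
  In a simple configuration the points of a subinterval carry consecutive numbers, beginning with the number
  of points to its left. This turns sums over points into sums over blocks of indices.
\<close>

lemma bij_betw_nth_point:
  assumes N: "N \<in> configs borel window" and s: "\<And>x. cnt N {x} \<le> 1"
    and ord: "a \<le> c" "c \<le> d" "d \<le> b"
  shows "bij_betw (\<lambda>j. nth_point a b j N) {cnt N {a<..c}..<cnt N {a<..d}} (point_set N \<inter> {c<..d})"
proof -
  define xs where "xs = sorted_list_of_set (point_set N \<inter> {a<..b})"
  have fin: "finite (point_set N \<inter> {a<..b})" by (rule real_configs_Ioc(3)[OF N])
  have xs: "sorted xs" "distinct xs" "set xs = point_set N \<inter> {a<..b}"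
    using fin by (auto simp: xs_def)
  have "cnt N {x} = 1" if "x \<in> point_set N" for x
    using that s[of x] real_configs_singleton(2)[OF N, of x] by simp
  then have card: "cnt N {a<..x} = card {y \<in> set xs. y \<le> x}" if "x \<le> b" for x
    unfolding real_configs_Ioc(2)[OF N] xs(3) using that
    by (simp, intro arg_cong[of _ _ card]) auto
  have le: "xs ! j \<le> x \<longleftrightarrow> j < cnt N {a<..x}" if "j < length xs" "x \<le> b" for j x
    using nth_le_iff_card[OF xs(1,2) that(1), of x] card[OF that(2)] by (simp only:)
  have "cnt N {a<..b} = card {y \<in> set xs. y \<le> b}" by (rule card) simp
  also have "{y \<in> set xs. y \<le> b} = set xs" unfolding xs(3) by auto
  also have "card (set xs) = length xs" by (rule distinct_card[OF xs(2)])
  finally have len: "length xs = cnt N {a<..b}" by (rule sym)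
  have nth: "nth_point a b j N = xs ! j" if j: "j < length xs" for j
    unfolding nth_point_def
  proof (rule cInf_eq_minimum)
    have "xs ! j \<in> set xs" using j by simp
    then have "a < xs ! j" "xs ! j \<le> b" using xs(3) by auto
    then show "xs ! j \<in> insert b {x. a < x \<and> j < cnt N {a<..x}}" using le[OF j, of "xs ! j"] by auto
    fix x assume "x \<in> insert b {x. a < x \<and> j < cnt N {a<..x}}"
    then show "xs ! j \<le> x" using le[OF j, of x] \<open>xs ! j \<le> b\<close> by (cases "x \<le> b") auto
  qed
  have sub: "{cnt N {a<..c}..<cnt N {a<..d}} \<subseteq> {..<length xs}"
    using cnt_Ioc_mono[OF N ord(3), of a] len by auto
  have "bij_betw ((!) xs) {cnt N {a<..c}..<cnt N {a<..d}} (point_set N \<inter> {c<..d})"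
    unfolding bij_betw_def
  proof
    show "inj_on ((!) xs) {cnt N {a<..c}..<cnt N {a<..d}}"
      by (rule inj_on_nth[OF xs(2)]) (use sub in auto)
    show "(!) xs ` {cnt N {a<..c}..<cnt N {a<..d}} = point_set N \<inter> {c<..d}"
    proof (intro equalityI subsetI)
      fix y assume "y \<in> (!) xs ` {cnt N {a<..c}..<cnt N {a<..d}}"
      then obtain j where j: "y = xs ! j" "cnt N {a<..c} \<le> j" "j < cnt N {a<..d}" by auto
      moreover have l: "j < length xs" using sub j by auto
      moreover have "y \<in> set xs" using j l by simp
      ultimately show "y \<in> point_set N \<inter> {c<..d}" using le[OF l, of c] le[OF l, of d] ord xs(3) by auto
    next
      fix y assume y: "y \<in> point_set N \<inter> {c<..d}"
      then have "y \<in> set xs" using ord xs(3) by auto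
      then obtain j where l: "j < length xs" "y = xs ! j" by (auto simp: in_set_conv_nth)
      then show "y \<in> (!) xs ` {cnt N {a<..c}..<cnt N {a<..d}}"
        using le[OF l(1), of c] le[OF l(1), of d] ord y by auto
    qed
  qed
  then show ?thesis using nth sub by (subst bij_betw_cong) auto
qed

definition cell :: "real \<Rightarrow> real \<Rightarrow> nat \<Rightarrow> real set" where
  "cell s w i = {s + real i * w <.. s + real (Suc i) * w}"

lemma cell_sets [simp]: "cell s w i \<in> sets borel" by (simp add: cell_def)

lemma cnt_Ioc_eq_sum_cells:
  assumes N: "N \<in> configs borel window" and w: "0 < w"
  shows "cnt N {s<..s + real m * w} = (\<Sum>i<m. cnt N (cell s w i))"
proof (induction m)
  case 0
  then show ?case by (simp add: cnt_def)
next
  case (Suc m)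
  have "cnt N {s<..s + real (Suc m) * w} = cnt N {s<..s + real m * w} + cnt N (cell s w m)"
    unfolding cell_def using w by (intro real_configs_Ioc_add[OF N]) (auto simp: algebra_simps)
  then show ?case using Suc by simp
qed

lemma cells_disjoint: "0 < w \<Longrightarrow> disjoint_family (cell s w)"
proof -
  assume w: "0 < w"
  have "cell s w i \<inter> cell s w j = {}" if "i < j" for i j
  proof -
    have "real (Suc i) * w \<le> real j * w" using that w by (intro mult_right_mono) auto
    then show ?thesis by (auto simp: cell_def)
  qed
  then show ?thesis unfolding disjoint_family_on_def by (metis Int_commute linorder_neqE_nat)
qed

lemma real_in_unit_cell: "\<exists>z::int. x \<in> {real_of_int z<..real_of_int z + 1}"
  by (rule exI[of _ "\<lceil>x\<rceil> - 1"]) (simp, linarith)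

lemma concat_map_upt:
  assumes c: "\<And>i. c i \<le> c (Suc i)" and "c 0 = 0"
  shows "concat (map (\<lambda>i. map f [c i..<c (Suc i)]) [0..<m]) = map f [0..<c m]"
proof (induction m)
  case (Suc m)
  have "[0..<c (Suc m)] = [0..<c m] @ [c m..<c (Suc m)]"
    using c[of m] upt_add_eq_append[of 0 "c m" "c (Suc m) - c m"] by simp
  then show ?case using Suc by simp
qed (simp add: assms)

text \<open>
  A list of lists is determined by the lengths of its members and by their concatenation. The law of
  the marks is given for a single enumeration of all points, so this is how the marks are distributed over
  consecutive cells.
\<close>

lemma blocks_eq_iff:
  assumes c: "\<And>i. c i \<le> c (Suc i)" "c 0 = 0"
  shows "map (\<lambda>i. map f [c i..<c (Suc i)]) [0..<m] = ls \<longleftrightarrow>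
    length ls = m \<and> (\<forall>i<m. c (Suc i) - c i = length (ls ! i)) \<and>
    (\<forall>j<length (concat ls). f j = concat ls ! j)" (is "?L = ls \<longleftrightarrow> ?R")
proof
  assume L: "?L = ls"
  then have "length ls = m" by auto
  moreover have "c (Suc i) - c i = length (ls ! i)" if "i < m" for i using L that by auto
  moreover have "concat ls = map f [0..<c m]" using concat_map_upt[of c f m, OF c] L by simp
  then have "f j = concat ls ! j" if "j < length (concat ls)" for j using that by simp
  ultimately show ?R by blast
next
  assume R: ?R
  have len: "map length ?L = map length ls" using R by (auto intro!: nth_equalityI)
  then have "length (concat ls) = length (concat ?L)" unfolding length_concat by simp
  then have l: "length (concat ls) = c m" unfolding concat_map_upt[of c f m, OF c] by simp
  then have "concat ls = map f [0..<c m]" using R by (intro nth_equalityI) auto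
  then have "concat ?L = concat ls" unfolding concat_map_upt[of c f m, OF c] by simp
  moreover have "\<forall>(x, y)\<in>set (zip ?L ls). length x = length y" 
    using R by (auto simp: set_zip)
  ultimately show "?L = ls" using R by (intro concat_injective) auto
qed

section \<open>Lists of independent random variables\<close>

lemma pmf_replicate_pmf:
  "pmf (replicate_pmf n p) xs = (if length xs = n then prod_list (map (pmf p) xs) else 0)"
proof (induction n arbitrary: xs)
  case 0
  then show ?case by (auto simp: pmf_return)
next
  case (Suc n)
  have eq: "replicate_pmf (Suc n) p = map_pmf (\<lambda>(x, xs). x # xs) (pair_pmf p (replicate_pmf n p))"
    by (simp add: pair_pmf_def map_pmf_def bind_assoc_pmf bind_return_pmf)
  show ?case
  proof (cases xs)
    case Nil
    have "[] \<notin> set_pmf (replicate_pmf (Suc n) p)" by (simp add: set_replicate_pmf)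
    then show ?thesis by (simp add: Nil pmf_eq_0_set_pmf del: replicate_pmf.simps)
  next
    case (Cons y ys)
    have "inj (\<lambda>(x :: 'a, xs). x # xs)" by (auto simp: inj_def)
    from pmf_map_inj'[OF this, of "pair_pmf p (replicate_pmf n p)" "(y, ys)"]
    have "pmf (replicate_pmf (Suc n) p) xs = pmf p y * pmf (replicate_pmf n p) ys"
      unfolding eq by (simp add: Cons pmf_pair)
    then show ?thesis by (simp add: Suc.IH Cons del: replicate_pmf.simps)
  qed
qed

lemma map_replicate_pmf: "map_pmf (map f) (replicate_pmf n p) = replicate_pmf n (map_pmf f p)"
proof (induction n)
  case (Suc n)
  show ?case by (simp add: Suc.IH[symmetric]) (simp add: map_pmf_def bind_assoc_pmf bind_return_pmf)
qed simp

lemma prod_list_map_concat: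
  "prod_list (map f (concat ls)) = prod_list (map (\<lambda>l. prod_list (map f l)) ls)" for f :: "'a \<Rightarrow> real"
  by (induction ls) auto

lemma prod_list_map_mult:
  "prod_list (map (\<lambda>x. f x * g x) xs) = prod_list (map f xs) * prod_list (map g xs)" for f :: "'a \<Rightarrow> real"
  by (induction xs) auto

lemma expectation_bind_pmf:
  fixes f :: "'a \<Rightarrow> real"
  assumes "\<And>x. \<bar>f x\<bar> \<le> B"
  shows "measure_pmf.expectation (bind_pmf p g) f = measure_pmf.expectation p (\<lambda>x. measure_pmf.expectation (g x) f)"
  unfolding measure_pmf_bind
  by (rule integral_bind[where K = "count_space UNIV" and B = B and B' = 1])
    (use assms measurable_space[OF measurable_measure_pmf, of _ g] measure_pmf.emeasure_space_1 in \<open>auto simp: measure_pmf.finite_measure\<close>)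

text \<open>
  Initial and final segment of a list of independent entries are independent.
\<close>

lemma expectation_replicate_pmf_append:
  fixes f g :: "'a list \<Rightarrow> real"
  assumes f: "\<And>x. \<bar>f x\<bar> \<le> 1" and g: "\<And>x. \<bar>g x\<bar> \<le> 1"
  shows "measure_pmf.expectation (replicate_pmf (m + n) q) (\<lambda>v. f (take m v) * g (drop m v)) =
    measure_pmf.expectation (replicate_pmf m q) f * measure_pmf.expectation (replicate_pmf n q) g"
proof -
  have b: "\<bar>f x * g y\<bar> \<le> 1" for x y
    using mult_mono[OF f[of x] g[of y]] by (simp add: abs_mult)
  have "measure_pmf.expectation (replicate_pmf (m + n) q) (\<lambda>v. f (take m v) * g (drop m v)) =
     measure_pmf.expectation (replicate_pmf m q) (\<lambda>xs. measure_pmf.expectation (replicate_pmf n q)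
       (\<lambda>ys. f (take m (xs @ ys)) * g (drop m (xs @ ys))))"
    unfolding replicate_pmf_distrib
    by (subst expectation_bind_pmf[where B = 1], rule b, subst expectation_bind_pmf[where B = 1], rule b) simp
  also have "\<dots> = measure_pmf.expectation (replicate_pmf m q) (\<lambda>xs. f xs * measure_pmf.expectation (replicate_pmf n q) g)"
    by (intro integral_cong_AE) (auto simp: AE_measure_pmf_iff set_replicate_pmf)
  finally show ?thesis by simp
qed

lemma expectation_sign_replicate_pmf:
  "measure_pmf.expectation (replicate_pmf n q) (\<lambda>v. (-1) ^ sum_list v :: real) =
    measure_pmf.expectation q (\<lambda>k. (-1) ^ k) ^ n"
proof (induction n)
  case (Suc n)
  have "measure_pmf.expectation (replicate_pmf (Suc n) q) (\<lambda>v. (-1) ^ sum_list v :: real) =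
     measure_pmf.expectation q (\<lambda>k. measure_pmf.expectation (replicate_pmf n q) (\<lambda>v. (-1) ^ k * (-1) ^ sum_list v))"
    unfolding replicate_pmf.simps
    by (subst expectation_bind_pmf[where B = 1], simp add: power_abs, subst expectation_bind_pmf[where B = 1], simp add: power_abs)
      (simp add: power_add)
  then show ?case using Suc by simp
qed simp

text \<open>
  The expectation of a sign has modulus \<open>1\<close> only if the sign is almost surely constant.
\<close>

lemma expectation_sign_less_1:
  assumes e: "k \<in> set_pmf q" "even k" and o: "l \<in> set_pmf q" "odd l"
  shows "\<bar>measure_pmf.expectation q (\<lambda>k. (-1) ^ k :: real)\<bar> < 1"
proof -
  have i: "measure_pmf.expectation q (indicator {j} :: nat \<Rightarrow> real) = pmf q j" for j
    by (simp add: measure_pmf_single)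
  have int: "integrable (measure_pmf q) (\<lambda>k. (-1) ^ k :: real)" "integrable (measure_pmf q) (indicator {j} :: nat \<Rightarrow> real)" for j
    by (auto intro!: measure_pmf.integrable_const_bound[where B = 1] simp: power_abs indicator_def)
  have "measure_pmf.expectation q (\<lambda>k. (-1) ^ k :: real) \<le> measure_pmf.expectation q (\<lambda>k. 1 - 2 * indicator {l} k)"
  proof (rule integral_mono)
    show "integrable q (\<lambda>k. 1 - 2 * indicator {l} k :: real)"
      by (intro Bochner_Integration.integrable_diff integrable_mult_right int) simp
  qed (use o int in \<open>auto simp: indicator_def minus_one_power_iff\<close>)
  also have "\<dots> = 1 - 2 * pmf q l" using int by (simp add: measure_pmf_single)
  finally have "measure_pmf.expectation q (\<lambda>k. (-1) ^ k :: real) < 1" using pmf_positive[OF o(1)] by simp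
  moreover have "measure_pmf.expectation q (\<lambda>j. 2 * indicator {k} j - 1) \<le> measure_pmf.expectation q (\<lambda>k. (-1) ^ k :: real)"
  proof (rule integral_mono)
    show "integrable q (\<lambda>j. 2 * indicator {k} j - 1 :: real)"
      by (intro Bochner_Integration.integrable_diff integrable_mult_right int) simp
  qed (use e int in \<open>auto simp: indicator_def minus_one_power_iff\<close>)
  then have "2 * pmf q k - 1 \<le> measure_pmf.expectation q (\<lambda>k. (-1) ^ k :: real)" using int by (simp add: measure_pmf_single)
  moreover have "0 < pmf q k" using pmf_positive[OF e(1)] .
  ultimately show ?thesis by (simp add: abs_less_iff)
qed

section \<open>Independent increments of the marked Poisson process\<close>

locale marked_poisson = prob_space \<Omega> for \<Omega> :: "'w measure" +
  fixes P \<xi> :: "'w \<Rightarrow> real measure" and \<mu> :: "nat pmf"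
  assumes poisson: "poisson_process \<Omega> 1 P" and iid: "iid_marks \<Omega> P \<mu> \<xi>" and pos: "0 \<notin> set_pmf \<mu>"
begin

lemma P_measurable: "P \<in> \<Omega> \<rightarrow>\<^sub>M real_configs" and \<xi>_measurable: "\<xi> \<in> \<Omega> \<rightarrow>\<^sub>M real_configs"
  using poisson iid by (auto simp: poisson_process_def iid_marks_def)

lemma P_config: "\<omega> \<in> space \<Omega> \<Longrightarrow> P \<omega> \<in> configs borel window"
  and \<xi>_config: "\<omega> \<in> space \<Omega> \<Longrightarrow> \<xi> \<omega> \<in> configs borel window"
  using measurable_space[OF P_measurable] measurable_space[OF \<xi>_measurable] by auto

lemma measurable_P_Ioc [measurable]: "(\<lambda>\<omega>. cnt (P \<omega>) {a<..b}) \<in> \<Omega> \<rightarrow>\<^sub>M count_space UNIV"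
  and measurable_\<xi>_Ioc [measurable]: "(\<lambda>\<omega>. cnt (\<xi> \<omega>) {a<..b}) \<in> \<Omega> \<rightarrow>\<^sub>M count_space UNIV"
  by (rule measurable_compose[OF P_measurable measurable_cnt_Ioc] measurable_compose[OF \<xi>_measurable measurable_cnt_Ioc])+

lemma measurable_P_cell [measurable]: "(\<lambda>\<omega>. cnt (P \<omega>) (cell s w i)) \<in> \<Omega> \<rightarrow>\<^sub>M count_space UNIV"
  and measurable_\<xi>_cell [measurable]: "(\<lambda>\<omega>. cnt (\<xi> \<omega>) (cell s w i)) \<in> \<Omega> \<rightarrow>\<^sub>M count_space UNIV"
  unfolding cell_def by measurable

lemma prob_cnt_Ioc:
  assumes "a < b"
  shows "prob {\<omega> \<in> space \<Omega>. cnt (P \<omega>) {a<..b} = k} = pmf (poisson_pmf (b - a)) k"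
proof -
  have "{\<omega> \<in> space \<Omega>. cnt (P \<omega>) {a<..b} = k} = {\<omega> \<in> space \<Omega>. emeasure (P \<omega>) {a<..b} = of_nat k}"
    using real_configs_Ioc(1)[OF P_config] by (intro Collect_cong conj_cong refl) auto
  then show ?thesis using poisson assms by (simp add: poisson_process_def)
qed

lemma prob_cnt_cells:
  assumes w: "0 < w"
  shows "prob {\<omega> \<in> space \<Omega>. \<forall>i<m. cnt (P \<omega>) (cell s w i) = k i} = (\<Prod>i<m. pmf (poisson_pmf w) (k i))"
proof (cases "m = 0")
  case True
  then show ?thesis by (simp add: prob_space)
next
  case False
  let ?E = "\<lambda>i. (\<lambda>\<omega>. emeasure (P \<omega>) (cell s w i)) -` {of_nat (k i)} \<inter> space \<Omega>"
  have ind: "indep_vars (\<lambda>_. borel) (\<lambda>i \<omega>. emeasure (P \<omega>) (cell s w i)) {..<m}"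
    using conjunct2[OF conjunct2[OF poisson[unfolded poisson_process_def]], rule_format, of m "cell s w"]
      disjoint_family_on_mono[OF subset_UNIV cells_disjoint[OF w, of s]] by simp
  have cnt: "emeasure (P \<omega>) (cell s w i) = of_nat (cnt (P \<omega>) (cell s w i))" if "\<omega> \<in> space \<Omega>" for \<omega> i
    unfolding cell_def by (rule real_configs_Ioc(1)[OF P_config[OF that]])
  have E: "?E i = {\<omega> \<in> space \<Omega>. cnt (P \<omega>) (cell s w i) = k i}" for i
    using cnt by auto
  have "{\<omega> \<in> space \<Omega>. \<forall>i<m. cnt (P \<omega>) (cell s w i) = k i} = (\<Inter>i\<in>{..<m}. ?E i)"
    unfolding E using False by auto
  also have "prob \<dots> = (\<Prod>i<m. prob (?E i))"
    using False by (intro indep_varsD[OF ind]) auto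
  also have "\<dots> = (\<Prod>i<m. pmf (poisson_pmf w) (k i))"
    unfolding E unfolding cell_def using w
    by (intro prod.cong refl, subst prob_cnt_Ioc) (auto simp: algebra_simps)
  finally show ?thesis .
qed

text \<open>
  The probability is \<open>1 - (1 + w) * exp (- w)\<close>, and \<open>exp (- w) \<ge> 1 - w\<close>.
\<close>

lemma prob_two_points_le:
  assumes w: "0 < w"
  shows "prob {\<omega> \<in> space \<Omega>. 2 \<le> cnt (P \<omega>) (cell s w i)} \<le> w\<^sup>2"
proof -
  have p: "prob {\<omega> \<in> space \<Omega>. cnt (P \<omega>) (cell s w i) = k} = w ^ k / fact k * exp (- w)" for k
    unfolding cell_def using w by (subst prob_cnt_Ioc) (auto simp: algebra_simps)
  have "1 = prob (space \<Omega>)" by (simp add: prob_space)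
  also have "space \<Omega> = {\<omega> \<in> space \<Omega>. cnt (P \<omega>) (cell s w i) = 0} \<union> {\<omega> \<in> space \<Omega>. cnt (P \<omega>) (cell s w i) = 1}
     \<union> {\<omega> \<in> space \<Omega>. 2 \<le> cnt (P \<omega>) (cell s w i)}" (is "_ = ?A \<union> ?B \<union> ?C") by auto
  also have "prob \<dots> = prob (?A \<union> ?B) + prob ?C" by (rule finite_measure_Union) (measurable, auto)
  also have "prob (?A \<union> ?B) = prob ?A + prob ?B" by (rule finite_measure_Union) (measurable, auto)
  finally have "prob ?C = 1 - (1 + w) * exp (- w)" unfolding p by (simp add: algebra_simps)
  moreover have "(1 + w) * (1 - w) \<le> (1 + w) * exp (- w)"
    using exp_ge_add_one_self[of "- w"] w by (intro mult_left_mono) auto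
  ultimately show ?thesis by (simp add: algebra_simps power2_eq_square)
qed

text \<open>
  A multiple point puts at least two points into one of \<open>n\<close> cells of width \<open>1 / n\<close>, which has probability
  at most \<open>n * (1 / n)\<^sup>2\<close>.
\<close>

lemma AE_simple_unit: "AE \<omega> in \<Omega>. \<forall>x\<in>{s<..s + 1}. cnt (P \<omega>) {x} \<le> 1"
proof -
  define B where "B n = {\<omega> \<in> space \<Omega>. \<exists>i<Suc n. 2 \<le> cnt (P \<omega>) (cell s (1 / real (Suc n)) i)}" for n
  have [measurable]: "B n \<in> sets \<Omega>" for n unfolding B_def by measurable
  have B: "prob (B n) \<le> 1 / real (Suc n)" for n
  proof -
    let ?w = "1 / real (Suc n)"
    have "prob (B n) = prob (\<Union>i\<in>{..<Suc n}. {\<omega> \<in> space \<Omega>. 2 \<le> cnt (P \<omega>) (cell s ?w i)})"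
      unfolding B_def by (intro arg_cong[of _ _ prob]) auto
    also have "\<dots> \<le> (\<Sum>i<Suc n. prob {\<omega> \<in> space \<Omega>. 2 \<le> cnt (P \<omega>) (cell s ?w i)})"
      by (rule finite_measure_subadditive_finite) (auto, measurable)
    also have "\<dots> \<le> (\<Sum>i<Suc n. ?w\<^sup>2)" by (intro sum_mono prob_two_points_le) auto
    also have "\<dots> = ?w" by (simp add: power2_eq_square del: of_nat_Suc)
    finally show ?thesis .
  qed
  have "prob (\<Inter>n. B n) \<le> 1 / real (Suc n)" for n
    by (rule order.trans[OF finite_measure_mono B[of n]]) auto
  moreover have "(\<lambda>n. 1 / real (Suc n)) \<longlonglongrightarrow> 0"
    using LIMSEQ_inverse_real_of_nat by (simp add: inverse_eq_divide)
  ultimately have "prob (\<Inter>n. B n) \<le> 0" by (intro LIMSEQ_le_const) auto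
  then have "(\<Inter>n. B n) \<in> null_sets \<Omega>"
    by (intro null_setsI) (auto simp: emeasure_eq_measure intro: antisym)
  then show ?thesis
  proof (rule AE_I')
    show "{\<omega> \<in> space \<Omega>. \<not> (\<forall>x\<in>{s<..s + 1}. cnt (P \<omega>) {x} \<le> 1)} \<subseteq> (\<Inter>n. B n)"
    proof (rule subsetI, rule INT_I)
      fix \<omega> n assume "\<omega> \<in> {\<omega> \<in> space \<Omega>. \<not> (\<forall>x\<in>{s<..s + 1}. cnt (P \<omega>) {x} \<le> 1)}"
      then obtain x where \<omega>: "\<omega> \<in> space \<Omega>" and x: "x \<in> {s<..s+1}" "\<not> cnt (P \<omega>) {x} \<le> 1" by auto
      let ?w = "1 / real (Suc n)"
      \<comment> \<open>The index of the cell that contains \<open>x\<close>; the subtraction accounts for cells being closed on the right.\<close>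
      define i where "i = nat (\<lceil>(x - s) * real (Suc n)\<rceil> - 1)"
      have "0 < (x - s) * real (Suc n)" using x by auto
      then have c: "0 < \<lceil>(x - s) * real (Suc n)\<rceil>" by linarith
      then have i: "real i < (x - s) * real (Suc n)" "(x - s) * real (Suc n) \<le> real (Suc i)"
        unfolding i_def by linarith+
      have "(x - s) * real (Suc n) \<le> 1 * real (Suc n)" using x by (intro mult_right_mono) auto
      from less_le_trans[OF i(1) this] have "i < Suc n" by (simp only: mult_1 of_nat_less_iff)
      moreover have "x \<in> cell s ?w i" using i by (auto simp: cell_def field_simps)
      then have "emeasure (P \<omega>) {x} \<le> emeasure (P \<omega>) (cell s ?w i)"
        using P_config[OF \<omega>] by (intro emeasure_mono) auto
      then have "cnt (P \<omega>) {x} \<le> cnt (P \<omega>) (cell s ?w i)"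
        unfolding cell_def real_configs_Ioc(1)[OF P_config[OF \<omega>]] real_configs_singleton(1)[OF P_config[OF \<omega>]] by simp
      ultimately show "\<omega> \<in> B n" using x \<omega> unfolding B_def by (auto intro!: exI[of _ i])
    qed
  qed
qed

lemma AE_simple: "AE \<omega> in \<Omega>. \<forall>x. cnt (P \<omega>) {x} \<le> 1"
proof -
  have "AE \<omega> in \<Omega>. \<forall>z::int. \<forall>x\<in>{real_of_int z<..real_of_int z + 1}. cnt (P \<omega>) {x} \<le> 1"
    unfolding AE_all_countable using AE_simple_unit by blast
  then show ?thesis
    by (rule AE_mp) (intro AE_I2 impI allI, use real_in_unit_cell in blast)
qed

definition mark :: "real \<Rightarrow> real \<Rightarrow> nat \<Rightarrow> nat \<Rightarrow> 'w \<Rightarrow> nat" where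
  "mark s w m j \<omega> = cnt (\<xi> \<omega>) {nth_point s (s + real m * w) j (P \<omega>)}"

text \<open>
  The marks of the points in each of \<open>m\<close> consecutive cells, from left to right. All cells share one
  enumeration, and the counts to the left of the cell boundaries delimit the block of each cell.
\<close>

definition mark_lists :: "real \<Rightarrow> real \<Rightarrow> nat \<Rightarrow> 'w \<Rightarrow> nat list list" where
  "mark_lists s w m \<omega> = map (\<lambda>i. map (\<lambda>j. mark s w m j \<omega>)
     [cnt (P \<omega>) {s<..s + real i * w}..<cnt (P \<omega>) {s<..s + real (Suc i) * w}]) [0..<m]"

lemma mark_lists_eq_iff:
  assumes \<omega>: "\<omega> \<in> space \<Omega>" and w: "0 < w"
  shows "mark_lists s w m \<omega> = ls \<longleftrightarrow> length ls = m \<and>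
     (\<forall>i<m. cnt (P \<omega>) (cell s w i) = length (ls ! i)) \<and>
     (\<forall>j<length (concat ls). mark s w m j \<omega> = concat ls ! j)"
proof -
  have *: "cnt (P \<omega>) {s<..s + real (Suc i) * w} = cnt (P \<omega>) {s<..s + real i * w} + cnt (P \<omega>) (cell s w i)" for i
    unfolding cnt_Ioc_eq_sum_cells[OF P_config[OF \<omega>] w] by simp
  show ?thesis unfolding mark_lists_def
    by (subst blocks_eq_iff) (use * in \<open>auto simp: cnt_def[of _ "{}"]\<close>)
qed

lemma measurable_mark [measurable]:
  assumes "0 < w" shows "mark s w m j \<in> \<Omega> \<rightarrow>\<^sub>M count_space UNIV"
proof -
  have "(\<lambda>\<omega>. nth_point s (s + real m * w) j (P \<omega>)) \<in> borel_measurable \<Omega>"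
    using assms by (intro measurable_compose[OF P_measurable measurable_nth_point]) simp
  then have "(\<lambda>\<omega>. emeasure (\<xi> \<omega>) {nth_point s (s + real m * w) j (P \<omega>)}) \<in> borel_measurable \<Omega>"
    by (rule measurable_emeasure_random_point[OF \<xi>_measurable])
  then show ?thesis unfolding mark_def cnt_def by measurable
qed

lemma measurable_mark_lists [measurable]:
  assumes w: "0 < w" shows "mark_lists s w m \<in> \<Omega> \<rightarrow>\<^sub>M count_space UNIV"
proof (subst measurable_count_space_eq2_countable, safe)
  fix ls
  note [measurable] = measurable_mark[OF w]
  have "mark_lists s w m -` {ls} \<inter> space \<Omega> = {\<omega> \<in> space \<Omega>. mark_lists s w m \<omega> = ls}" by auto
  also have "\<dots> = {\<omega> \<in> space \<Omega>. length ls = m \<and>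
     (\<forall>i<m. cnt (P \<omega>) (cell s w i) = length (ls ! i)) \<and>
     (\<forall>j<length (concat ls). mark s w m j \<omega> = concat ls ! j)}"
    by (intro Collect_cong conj_cong refl mark_lists_eq_iff w)
  also have "\<dots> \<in> sets \<Omega>" by measurable
  finally show "mark_lists s w m -` {ls} \<inter> space \<Omega> \<in> sets \<Omega>" .
qed auto

definition cell_pmf :: "real \<Rightarrow> nat list pmf" where
  "cell_pmf w = bind_pmf (poisson_pmf w) (\<lambda>n. replicate_pmf n \<mu>)"

lemma pmf_cell_pmf:
  "pmf (cell_pmf w) l = pmf (poisson_pmf w) (length l) * prod_list (map (pmf \<mu>) l)"
proof -
  have "pmf (cell_pmf w) l = (\<integral>n. prod_list (map (pmf \<mu>) l) * indicator {length l} n \<partial>measure_pmf (poisson_pmf w))"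
    unfolding cell_pmf_def pmf_bind pmf_replicate_pmf
    by (intro Bochner_Integration.integral_cong refl) (auto simp: indicator_def)
  then show ?thesis by (simp add: measure_pmf_single mult.commute)
qed

text \<open>
  The event fixes the numbers of points in the cells, which is an event of \<open>P\<close>, and the marks of all these
  points. Conditionally on \<open>P\<close> the latter has the constant probability given by the product of \<open>\<mu>\<close>, and the
  former has product probability by independence of the Poisson counts.
\<close>

lemma prob_mark_lists:
  assumes w: "0 < w"
  shows "prob {\<omega> \<in> space \<Omega>. mark_lists s w m \<omega> = ls} = pmf (replicate_pmf m (cell_pmf w)) ls"
proof (cases "length ls = m")
  case False
  then have *: "{\<omega> \<in> space \<Omega>. mark_lists s w m \<omega> = ls} = {}" by (auto simp: mark_lists_def)
  show ?thesis unfolding * using False by (simp add: pmf_replicate_pmf)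
next
  case len: True
  define n where "n = length (concat ls)"
  define X where "X j \<omega> = nth_point s (s + real m * w) j (P \<omega>)" for j \<omega>
  define \<sigma>P where "\<sigma>P = vimage_algebra (space \<Omega>) P real_configs"
  define B where "B = {\<omega> \<in> space \<Omega>. \<forall>i<m. cnt (P \<omega>) (cell s w i) = length (ls ! i)}"
  define Ev where "Ev = {\<omega> \<in> space \<Omega>. \<forall>j<n. emeasure (\<xi> \<omega>) {X j \<omega>} = of_nat (concat ls ! j)}"
  define c where "c = (\<Prod>j<n. pmf \<mu> (concat ls ! j))"
  have sub: "subalgebra \<Omega> \<sigma>P"
    unfolding subalgebra_def \<sigma>P_def using P_measurable by (auto simp: measurable_iff_sets)
  interpret fin: finite_measure_subalgebra \<Omega> \<sigma>P by unfold_locales (rule sub)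
  have X\<sigma>: "X j \<in> borel_measurable \<sigma>P" for j
    unfolding X_def \<sigma>P_def using w measurable_space[OF P_measurable]
    by (intro measurable_compose[OF measurable_vimage_algebra1 measurable_nth_point]) auto
  have X: "X j \<in> borel_measurable \<Omega>" for j using measurable_from_subalg[OF sub X\<sigma>] .
  have Ev [measurable]: "Ev \<in> sets \<Omega>"
  proof -
    have [measurable]: "(\<lambda>\<omega>. emeasure (\<xi> \<omega>) {X j \<omega>}) \<in> borel_measurable \<Omega>" for j
      by (rule measurable_emeasure_random_point[OF \<xi>_measurable X])
    show ?thesis unfolding Ev_def by measurable
  qed
  have B\<sigma>: "B \<in> sets \<sigma>P"
  proof -
    have [measurable]: "(\<lambda>N. cnt N (cell s w i)) \<in> real_configs \<rightarrow>\<^sub>M count_space UNIV" for i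
      unfolding cell_def by (rule measurable_cnt_Ioc)
    have "{N \<in> space real_configs. \<forall>i<m. cnt N (cell s w i) = length (ls ! i)} \<in> sets real_configs" by measurable
    then have "P -` {N \<in> space real_configs. \<forall>i<m. cnt N (cell s w i) = length (ls ! i)} \<inter> space \<Omega> \<in> sets \<sigma>P"
      unfolding \<sigma>P_def by (rule in_vimage_algebra)
    also have "P -` {N \<in> space real_configs. \<forall>i<m. cnt N (cell s w i) = length (ls ! i)} \<inter> space \<Omega> = B"
      using P_config by (auto simp: B_def)
    finally show ?thesis .
  qed
  then have [measurable]: "B \<in> sets \<Omega>" using sub by (auto simp: subalgebra_def)
  \<comment> \<open>The event splits into a condition on the counts of \<open>P\<close> and one on the marks of the enumerated points.\<close>
  have ev: "{\<omega> \<in> space \<Omega>. mark_lists s w m \<omega> = ls} = B \<inter> Ev"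
    using len by (auto simp: mark_lists_eq_iff[OF _ w] B_def Ev_def n_def mark_def X_def real_configs_singleton(1)[OF \<xi>_config])
  have "AE \<omega> in \<Omega>. inj_on (\<lambda>j. X j \<omega>) {..<n} \<and> (\<forall>j<n. X j \<omega> \<in> point_set (P \<omega>)) \<longrightarrow>
      real_cond_exp \<Omega> \<sigma>P (indicator Ev) \<omega> = c"
    using iid X\<sigma> unfolding iid_marks_def Let_def Ev_def c_def \<sigma>P_def by blast
  moreover have "AE \<omega> in \<Omega>. \<omega> \<in> B \<longrightarrow> inj_on (\<lambda>j. X j \<omega>) {..<n} \<and> (\<forall>j<n. X j \<omega> \<in> point_set (P \<omega>))"
    using AE_simple
  proof (rule AE_mp, intro AE_I2 impI)
    fix \<omega> assume \<omega>: "\<omega> \<in> space \<Omega>" and s: "\<forall>x. cnt (P \<omega>) {x} \<le> 1" and B: "\<omega> \<in> B"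
    have "n = sum_list (map length ls)" by (simp add: n_def length_concat)
    also have "\<dots> = (\<Sum>i<m. cnt (P \<omega>) (cell s w i))"
      using B len by (simp add: B_def sum.list_conv_set_nth atLeast0LessThan)
    also have "\<dots> = cnt (P \<omega>) {s<..s + real m * w}"
      by (rule cnt_Ioc_eq_sum_cells[OF P_config[OF \<omega>] w, symmetric])
    finally have n: "cnt (P \<omega>) {s<..s + real m * w} = n" by simp
    have "bij_betw (\<lambda>j. X j \<omega>) {cnt (P \<omega>) {s<..s}..<cnt (P \<omega>) {s<..s + real m * w}} (point_set (P \<omega>) \<inter> {s<..s + real m * w})"
      unfolding X_def using w s by (intro bij_betw_nth_point[OF P_config[OF \<omega>]]) auto
    then have "bij_betw (\<lambda>j. X j \<omega>) {..<n} (point_set (P \<omega>) \<inter> {s<..s + real m * w})"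
      by (simp add: n cnt_def[of _ "{}"] atLeast0LessThan)
    then show "inj_on (\<lambda>j. X j \<omega>) {..<n} \<and> (\<forall>j<n. X j \<omega> \<in> point_set (P \<omega>))"
      by (auto simp: bij_betw_def)
  qed
  ultimately have ce: "AE \<omega> in \<Omega>. \<omega> \<in> B \<longrightarrow> real_cond_exp \<Omega> \<sigma>P (indicator Ev) \<omega> = c" by eventually_elim blast
  have "prob (B \<inter> Ev) = (\<integral>\<omega>\<in>B. indicator Ev \<omega> \<partial>\<Omega>)"
    by (simp add: set_lebesgue_integral_def indicator_inter_arith[symmetric])
  also have "\<dots> = (\<integral>\<omega>\<in>B. real_cond_exp \<Omega> \<sigma>P (indicator Ev) \<omega> \<partial>\<Omega>)"
    by (rule fin.real_cond_exp_intA[OF integrable_real_indicator B\<sigma>]) (auto simp: emeasure_eq_measure)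
  also have "\<dots> = (\<integral>\<omega>. indicator B \<omega> * c \<partial>\<Omega>)"
    unfolding set_lebesgue_integral_def using ce
    by (intro integral_cong_AE) (auto simp: indicator_def)
  also have "\<dots> = prob B * c" by simp
  also have "prob B = (\<Prod>i<m. pmf (poisson_pmf w) (length (ls ! i)))"
    unfolding B_def by (rule prob_cnt_cells[OF w])
  also have "\<dots> = prod_list (map (\<lambda>l. pmf (poisson_pmf w) (length l)) ls)"
    using len by (simp add: prod.list_conv_set_nth atLeast0LessThan)
  also have "c = prod_list (map (pmf \<mu>) (concat ls))"
    unfolding c_def n_def by (simp add: prod.list_conv_set_nth atLeast0LessThan)
  finally show ?thesis unfolding ev pmf_replicate_pmf pmf_cell_pmf using len
    by (simp add: prod_list_map_concat prod_list_map_mult)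
qed

lemma distr_mark_lists:
  assumes w: "0 < w"
  shows "distr \<Omega> (count_space UNIV) (mark_lists s w m) = measure_pmf (replicate_pmf m (cell_pmf w))"
proof (rule measure_eqI_countable[of _ UNIV])
  fix ls
  have "emeasure (distr \<Omega> (count_space UNIV) (mark_lists s w m)) {ls} = emeasure \<Omega> {\<omega> \<in> space \<Omega>. mark_lists s w m \<omega> = ls}"
    using w by (subst emeasure_distr) (auto intro!: arg_cong[of _ _ "emeasure \<Omega>"])
  then show "emeasure (distr \<Omega> (count_space UNIV) (mark_lists s w m)) {ls} = emeasure (measure_pmf (replicate_pmf m (cell_pmf w))) {ls}"
    by (simp add: emeasure_eq_measure prob_mark_lists[OF w] emeasure_pmf_single)
qed (auto)

definition counts :: "real \<Rightarrow> real \<Rightarrow> nat \<Rightarrow> 'w \<Rightarrow> nat list" where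
  "counts s w m \<omega> = map (\<lambda>i. cnt (\<xi> \<omega>) (cell s w i)) [0..<m]"

lemma measurable_counts [measurable]: "counts s w m \<in> \<Omega> \<rightarrow>\<^sub>M count_space UNIV"
proof (subst measurable_count_space_eq2_countable, safe)
  fix xs
  have "counts s w m -` {xs} \<inter> space \<Omega> = {\<omega> \<in> space \<Omega>. counts s w m \<omega> = xs}" by auto
  also have "\<dots> = {\<omega> \<in> space \<Omega>. length xs = m \<and> (\<forall>i<m. cnt (\<xi> \<omega>) (cell s w i) = xs ! i)}"
    by (intro Collect_cong conj_cong refl) (auto simp: counts_def list_eq_iff_nth_eq)
  also have "\<dots> \<in> sets \<Omega>" by measurable
  finally show "counts s w m -` {xs} \<inter> space \<Omega> \<in> sets \<Omega>" .
qed auto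

lemma measurable_fun_counts [measurable]: "(\<lambda>\<omega>. \<psi> (counts s w k \<omega>)) \<in> borel_measurable \<Omega>"
  for \<psi> :: "nat list \<Rightarrow> real"
  by (rule measurable_compose[OF measurable_counts]) simp

lemma AE_\<xi>_subset_P: "AE \<omega> in \<Omega>. point_set (\<xi> \<omega>) \<subseteq> point_set (P \<omega>)"
  using iid by (simp add: iid_marks_def)

text \<open>
  The block of indices that \<open>mark_lists\<close> assigns to a cell enumerates the points of this cell.
\<close>

lemma mark_list_nth:
  assumes \<omega>: "\<omega> \<in> space \<Omega>" and s: "\<forall>x. cnt (P \<omega>) {x} \<le> 1" and w: "0 < w" and i: "i < m"
  shows "bij_betw (\<lambda>j. nth_point s (s + real m * w) j (P \<omega>))
    {cnt (P \<omega>) {s<..s + real i * w}..<cnt (P \<omega>) {s<..s + real (Suc i) * w}} (point_set (P \<omega>) \<inter> cell s w i)"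
proof -
  have "real (Suc i) * w \<le> real m * w" using i w by (intro mult_right_mono) auto
  then show ?thesis unfolding cell_def using w s
    by (intro bij_betw_nth_point[OF P_config[OF \<omega>]]) (auto intro: mult_right_mono)
qed

lemma AE_counts_eq:
  assumes w: "0 < w"
  shows "AE \<omega> in \<Omega>. counts s w m \<omega> = map sum_list (mark_lists s w m \<omega>)"
  using AE_simple AE_\<xi>_subset_P AE_space
proof eventually_elim
  case (elim \<omega>)
  note \<omega> = elim(3)
  have "cnt (\<xi> \<omega>) (cell s w i) = sum_list (map (\<lambda>j. mark s w m j \<omega>)
     [cnt (P \<omega>) {s<..s + real i * w}..<cnt (P \<omega>) {s<..s + real (Suc i) * w}])" if i: "i < m" for i
  proof -
    have fin: "finite (point_set (P \<omega>) \<inter> cell s w i)"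
      unfolding cell_def by (rule real_configs_Ioc(3)[OF P_config[OF \<omega>]])
    have "cnt (\<xi> \<omega>) (cell s w i) = (\<Sum>x\<in>point_set (\<xi> \<omega>) \<inter> cell s w i. cnt (\<xi> \<omega>) {x})"
      unfolding cell_def by (rule real_configs_Ioc(2)[OF \<xi>_config[OF \<omega>]])
    also have "\<dots> = (\<Sum>x\<in>point_set (P \<omega>) \<inter> cell s w i. cnt (\<xi> \<omega>) {x})"
      using elim(2) real_configs_singleton(2)[OF \<xi>_config[OF \<omega>]] by (intro sum.mono_neutral_left fin) auto
    also have "\<dots> = (\<Sum>j\<in>{cnt (P \<omega>) {s<..s + real i * w}..<cnt (P \<omega>) {s<..s + real (Suc i) * w}}. mark s w m j \<omega>)"
      unfolding mark_def by (rule sum.reindex_bij_betw[OF mark_list_nth[OF \<omega> elim(1) w i], symmetric])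
    finally show ?thesis by (simp add: interv_sum_list_conv_sum_set_nat)
  qed
  then show ?case by (simp add: counts_def mark_lists_def)
qed

definition increment_pmf :: "real \<Rightarrow> nat pmf" where
  "increment_pmf w = map_pmf sum_list (cell_pmf w)"

text \<open>
  The process \<open>\<xi>\<close> is a compound Poisson process: its increments over equal consecutive cells are independent
  and identically distributed.
\<close>

lemma distr_counts:
  assumes w: "0 < w"
  shows "distr \<Omega> (count_space UNIV) (counts s w m) = measure_pmf (replicate_pmf m (increment_pmf w))"
proof -
  have "distr \<Omega> (count_space UNIV) (counts s w m) =
      distr \<Omega> (count_space UNIV) (\<lambda>\<omega>. map sum_list (mark_lists s w m \<omega>))"
    using AE_counts_eq[OF w] measurable_mark_lists[OF w] by (intro distr_cong_AE) (auto intro: measurable_compose)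
  also have "\<dots> = distr (distr \<Omega> (count_space UNIV) (mark_lists s w m)) (count_space UNIV) (map sum_list)"
    using measurable_mark_lists[OF w] by (subst distr_distr) (auto simp: comp_def)
  also have "\<dots> = measure_pmf (map_pmf (map sum_list) (replicate_pmf m (cell_pmf w)))"
    unfolding distr_mark_lists[OF w] by (simp add: map_pmf_rep_eq)
  finally show ?thesis unfolding increment_pmf_def map_replicate_pmf .
qed

lemma expectation_counts:
  fixes G :: "nat list \<Rightarrow> real"
  assumes w: "0 < w"
  shows "expectation (\<lambda>\<omega>. G (counts s w m \<omega>)) = measure_pmf.expectation (replicate_pmf m (increment_pmf w)) G"
  unfolding distr_counts[OF w, symmetric, of m s] by (subst integral_distr) auto

lemma counts_append:
  "counts s w (m + n) \<omega> = counts s w m \<omega> @ counts (s + real m * w) w n \<omega>"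
proof (rule nth_equalityI)
  fix i assume i: "i < length (counts s w (m + n) \<omega>)"
  have "cell s w i = cell (s + real m * w) w (i - m)" if "m \<le> i"
    using that by (simp add: cell_def of_nat_diff algebra_simps)
  then show "counts s w (m + n) \<omega> ! i = (counts s w m \<omega> @ counts (s + real m * w) w n \<omega>) ! i"
    using i by (auto simp: counts_def nth_append)
qed (simp add: counts_def)

lemma set_cell_pmf:
  assumes "0 < w"
  shows "set_pmf (cell_pmf w) = lists (set_pmf \<mu>)"
  using assms by (auto simp: cell_pmf_def set_replicate_pmf)

lemma increment_pmf_0:
  assumes "0 < w" shows "0 \<in> set_pmf (increment_pmf w)"
  using set_cell_pmf[OF assms] by (auto simp: increment_pmf_def intro!: image_eqI[of _ _ "[]"])

lemma increment_pmf_single: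
  assumes "0 < w" and "k \<in> set_pmf \<mu>" shows "k \<in> set_pmf (increment_pmf w)"
  using set_cell_pmf[OF assms(1)] assms(2) by (auto simp: increment_pmf_def intro!: image_eqI[of _ _ "[k]"])

text \<open>
  Every mark occurs in the list of marks of a unit cell, and such a list has almost surely all its
  entries in the support of \<open>\<mu>\<close>, which omits \<open>0\<close>.
\<close>

lemma AE_marks_positive: "AE \<omega> in \<Omega>. point_set (P \<omega>) = point_set (\<xi> \<omega>)"
proof -
  have unit: "AE \<omega> in \<Omega>. point_set (P \<omega>) \<inter> cell s 1 0 \<subseteq> point_set (\<xi> \<omega>)" for s
  proof -
    have "AE ls in distr \<Omega> (count_space UNIV) (mark_lists s 1 1). \<forall>l\<in>set ls. 0 \<notin> set l"
      unfolding distr_mark_lists[OF zero_less_one]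
      using pos set_cell_pmf[OF zero_less_one] by (auto simp: AE_measure_pmf_iff set_replicate_pmf)
    then have "AE \<omega> in \<Omega>. \<forall>l\<in>set (mark_lists s 1 1 \<omega>). 0 \<notin> set l"
      using measurable_mark_lists[of 1 s 1] by (subst (asm) AE_distr_iff) auto
    then show ?thesis using AE_simple AE_space
    proof eventually_elim
      case (elim \<omega>)
      show ?case
      proof
        fix x assume "x \<in> point_set (P \<omega>) \<inter> cell s 1 0"
        then have "x \<in> (\<lambda>j. nth_point s (s + real 1 * 1) j (P \<omega>)) `
            {cnt (P \<omega>) {s<..s + real 0 * 1}..<cnt (P \<omega>) {s<..s + real (Suc 0) * 1}}"
          using bij_betw_imp_surj_on[OF mark_list_nth[OF elim(3,2), of 1 0 1 s]] by simp
        then obtain j where "j \<in> {cnt (P \<omega>) {s<..s + real 0 * 1}..<cnt (P \<omega>) {s<..s + real (Suc 0) * 1}}"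
          "x = nth_point s (s + real 1 * 1) j (P \<omega>)"
          by blast
        then have "mark s 1 1 j \<omega> \<noteq> 0" "mark s 1 1 j \<omega> = cnt (\<xi> \<omega>) {x}"
          using elim(1) by (auto simp: mark_lists_def mark_def)
        then show "x \<in> point_set (\<xi> \<omega>)"
          using real_configs_singleton(2)[OF \<xi>_config[OF elim(3)]] by simp
      qed
    qed
  qed
  have "AE \<omega> in \<Omega>. \<forall>z::int. point_set (P \<omega>) \<inter> cell (real_of_int z) 1 0 \<subseteq> point_set (\<xi> \<omega>)"
    unfolding AE_all_countable using unit by blast
  then show ?thesis using AE_\<xi>_subset_P
  proof eventually_elim
    case (elim \<omega>)
    have "x \<in> point_set (\<xi> \<omega>)" if "x \<in> point_set (P \<omega>)" for x
    proof -
      obtain z :: int where z: "x \<in> {real_of_int z<..real_of_int z + 1}" using real_in_unit_cell by blast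
      then show ?thesis using elim(1)[rule_format, of z] that by (auto simp: cell_def)
    qed
    then show ?case using elim(2) by auto
  qed
qed

end

section \<open>Approximation by functions of finitely many counts\<close>

text \<open>
  A large common multiple \<open>N\<close> of the two denominators gives a grid of mesh \<open>1 / N\<close> on \<open>{- N<..N}\<close> that has
  both numbers among its nodes.
\<close>

lemma Rats_common_grid:
  assumes "a \<in> \<rat>" "b \<in> \<rat>" "a \<le> b"
  obtains N p q :: nat where "0 < N" "p \<le> q" "q \<le> 2 * N * N"
    "a = - real N + real p * (1 / real N)" "b = - real N + real q * (1 / real N)"
proof -
  obtain i1 :: int and d1 :: nat where a: "a = of_int i1 / of_nat d1" "d1 \<noteq> 0"
    using assms(1) by (auto simp: Rats_eq_int_div_nat)
  obtain i2 :: int and d2 :: nat where b: "b = of_int i2 / of_nat d2" "d2 \<noteq> 0"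
    using assms(2) by (auto simp: Rats_eq_int_div_nat)
  obtain n where n: "\<bar>a\<bar> + \<bar>b\<bar> + 1 \<le> real n" using real_arch_simple by blast
  \<comment> \<open>The factor \<open>n\<close> makes the window contain \<open>a\<close> and \<open>b\<close>.\<close>
  define N where "N = d1 * d2 * n"
  have n0: "n \<noteq> 0" using n by (intro notI) simp
  then have N: "0 < N" using a b by (simp add: N_def)
  have "real n \<le> real N" using a b unfolding N_def of_nat_le_iff by simp
  then have le: "\<bar>a\<bar> \<le> real N" "\<bar>b\<bar> \<le> real N" using n by linarith+
  have "\<exists>p::nat. (x + real N) * real N = real p \<and> p \<le> 2 * N * N" if x: "\<bar>x\<bar> \<le> real N" "x * real N \<in> \<int>" for x
  proof -
    have "(x + real N) * real N \<in> \<int>" using x(2) by (simp add: algebra_simps)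
    then obtain z where z: "(x + real N) * real N = of_int z" by (auto elim: Ints_cases)
    have "0 \<le> (x + real N) * real N" using x(1) by (intro mult_nonneg_nonneg) auto
    then have "(x + real N) * real N = real (nat z)" unfolding z by simp
    moreover have "(x + real N) * real N \<le> (2 * real N) * real N" using x(1) by (intro mult_right_mono) auto
    ultimately have "real (nat z) \<le> real (2 * N * N)" by simp
    then show ?thesis using \<open>_ = real (nat z)\<close> by (intro exI[of _ "nat z"]) linarith
  qed
  note * = this
  have "a * real N = of_int (i1 * int d2 * int n)" "b * real N = of_int (i2 * int d1 * int n)"
    using a b by (auto simp: N_def field_simps)
  then have "a * real N \<in> \<int>" "b * real N \<in> \<int>" by (metis Ints_of_int)+
  then obtain p q :: nat where p: "(a + real N) * real N = real p" and q: "(b + real N) * real N = real q" "q \<le> 2 * N * N"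
    using *[OF le(1)] *[OF le(2)] by blast
  have "(a + real N) * real N \<le> (b + real N) * real N" using assms(3) by (intro mult_right_mono) auto
  then have "p \<le> q" unfolding p q by simp
  moreover have "a = - real N + real p * (1 / real N)" "b = - real N + real q * (1 / real N)"
    using N by (auto simp flip: p q(1))
  ultimately show ?thesis using that N q(2) by blast
qed

context marked_poisson
begin

lemma cnt_Ioc_counts:
  assumes \<omega>: "\<omega> \<in> space \<Omega>" and w: "0 < w" and pq: "p \<le> q" "q \<le> m"
  shows "cnt (\<xi> \<omega>) {s + real p * w<..s + real q * w} = (\<Sum>j\<in>{p..<q}. counts s w m \<omega> ! j)"
proof -
  have "cnt (\<xi> \<omega>) {s<..s + real q * w} = cnt (\<xi> \<omega>) {s<..s + real p * w} + cnt (\<xi> \<omega>) {s + real p * w<..s + real q * w}"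
    using w pq by (intro real_configs_Ioc_add[OF \<xi>_config[OF \<omega>]]) (auto intro: mult_right_mono)
  moreover have "(\<Sum>i<q. cnt (\<xi> \<omega>) (cell s w i)) = (\<Sum>i<p. cnt (\<xi> \<omega>) (cell s w i)) + (\<Sum>i\<in>{p..<q}. cnt (\<xi> \<omega>) (cell s w i))"
    using sum.atLeastLessThan_concat[of 0 p q "\<lambda>i. cnt (\<xi> \<omega>) (cell s w i)"] pq by (simp add: atLeast0LessThan)
  ultimately have "cnt (\<xi> \<omega>) {s + real p * w<..s + real q * w} = (\<Sum>i\<in>{p..<q}. cnt (\<xi> \<omega>) (cell s w i))"
    unfolding cnt_Ioc_eq_sum_cells[OF \<xi>_config[OF \<omega>] w] by linarith
  then show ?thesis using pq by (simp add: counts_def)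
qed

text \<open>
  The parameter \<open>N\<close> controls both the window \<open>{- N<..N}\<close> and the mesh \<open>1 / N\<close>, so that the grids are directed
  by divisibility of \<open>N\<close>.
\<close>

definition grid :: "nat \<Rightarrow> 'w \<Rightarrow> nat list" where
  "grid N = counts (- real N) (1 / real N) (2 * N * N)"

lemma grid_refine:
  assumes "0 < N" "0 < k"
  shows "\<exists>h. \<forall>\<omega>\<in>space \<Omega>. grid N \<omega> = h (grid (N * k) \<omega>)"
proof -
  define N' where "N' = N * k"
  \<comment> \<open>The position of the left end of coarse cell \<open>i\<close> among the nodes of the fine grid.\<close>
  define p where "p i = N' * (N' - N) + i * k" for i
  define h where "h v = map (\<lambda>i. \<Sum>j\<in>{p i..<p (Suc i)}. v ! j) [0..<2 * N * N]" for v :: "nat list"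
  have N': "0 < N'" "N \<le> N'" using assms by (auto simp: N'_def)
  have "grid N \<omega> = h (grid N' \<omega>)" if \<omega>: "\<omega> \<in> space \<Omega>" for \<omega>
  proof -
    have "cnt (\<xi> \<omega>) (cell (- real N) (1 / real N) i) = (\<Sum>j\<in>{p i..<p (Suc i)}. grid N' \<omega> ! j)" if i: "i < 2 * N * N" for i
    proof -
      have e: "- real N + real i * (1 / real N) = - real N' + real (p i) * (1 / real N')" for i
        using assms N' by (simp add: p_def of_nat_diff field_simps) (simp add: N'_def field_simps)
      have "Suc i * k \<le> 2 * N * N * k" using i by (intro mult_right_mono) auto
      also have "\<dots> = 2 * N * N'" by (simp add: N'_def)
      finally have "p (Suc i) \<le> N' * (N' - N) + 2 * N * N'" by (simp add: p_def)
      also have "\<dots> = N' * (N' + N)" using N' by (simp add: algebra_simps diff_mult_distrib2)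
      also have "\<dots> \<le> N' * (N' + N')" using N' by (intro mult_left_mono) auto
      finally have "p (Suc i) \<le> 2 * N' * N'" by (simp add: algebra_simps)
      then show ?thesis unfolding cell_def e grid_def using N'
        by (intro cnt_Ioc_counts[OF \<omega>]) (auto simp: p_def)
    qed
    then show ?thesis by (simp add: h_def grid_def counts_def)
  qed
  then show ?thesis unfolding N'_def by blast
qed

definition grid_event :: "nat \<Rightarrow> nat list set \<Rightarrow> 'w set" where
  "grid_event N Q = {\<omega> \<in> space \<Omega>. grid N \<omega> \<in> Q}"

lemma measurable_grid [measurable]: "grid N \<in> \<Omega> \<rightarrow>\<^sub>M count_space UNIV"
  unfolding grid_def by measurable

lemma grid_event_sets [measurable]: "grid_event N Q \<in> sets \<Omega>"
  unfolding grid_event_def by measurable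

text \<open>
  These events form the completion, inside \<open>\<Omega>\<close>, of the sigma-algebra generated by all grid counts.
\<close>

definition approximable :: "'w set \<Rightarrow> bool" where
  "approximable B \<longleftrightarrow> B \<in> sets \<Omega> \<and> (\<forall>\<epsilon>>0. \<exists>N Q. 0 < N \<and> prob (sym_diff B (grid_event N Q)) < \<epsilon>)"

lemma approximable_sets: "approximable B \<Longrightarrow> B \<in> sets \<Omega>" by (simp add: approximable_def)

lemma approximable_grid_event: "0 < N \<Longrightarrow> approximable (grid_event N Q)"
  unfolding approximable_def by (auto intro!: exI[of _ N] exI[of _ Q])

lemma approximable_compl:
  assumes "approximable B" shows "approximable (space \<Omega> - B)"
  unfolding approximable_def
proof (intro conjI allI impI)
  note [measurable] = approximable_sets[OF assms]
  show "space \<Omega> - B \<in> sets \<Omega>" by measurable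
  fix \<epsilon> :: real assume "0 < \<epsilon>"
  then obtain N Q where N: "0 < N" "prob (sym_diff B (grid_event N Q)) < \<epsilon>"
    using assms by (auto simp: approximable_def)
  have "sym_diff (space \<Omega> - B) (grid_event N (- Q)) = sym_diff B (grid_event N Q)"
    using sets.sets_into_space[OF approximable_sets[OF assms]] by (auto simp: grid_event_def)
  then show "\<exists>N Q. 0 < N \<and> prob (sym_diff (space \<Omega> - B) (grid_event N Q)) < \<epsilon>" using N by metis
qed

lemma approximable_Un:
  assumes A: "approximable A" and B: "approximable B" shows "approximable (A \<union> B)"
  unfolding approximable_def
proof (intro conjI allI impI)
  note [measurable] = approximable_sets[OF A] approximable_sets[OF B]
  show "A \<union> B \<in> sets \<Omega>" by measurable
  fix \<epsilon> :: real assume \<epsilon>: "0 < \<epsilon>"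
  obtain N Q where N: "0 < N" "prob (sym_diff A (grid_event N Q)) < \<epsilon> / 2"
    using A \<epsilon> by (auto simp: approximable_def dest: spec[of _ "\<epsilon> / 2"])
  obtain N' Q' where N': "0 < N'" "prob (sym_diff B (grid_event N' Q')) < \<epsilon> / 2"
    using B \<epsilon> by (auto simp: approximable_def dest: spec[of _ "\<epsilon> / 2"])
  obtain h where h: "\<forall>\<omega>\<in>space \<Omega>. grid N \<omega> = h (grid (N * N') \<omega>)" using grid_refine N N' by blast
  obtain h' where h': "\<forall>\<omega>\<in>space \<Omega>. grid N' \<omega> = h' (grid (N' * N) \<omega>)" using grid_refine N N' by blast
  define R where "R = h -` Q \<union> h' -` Q'"
  have "grid_event (N * N') R = grid_event N Q \<union> grid_event N' Q'"
    using h h' by (auto simp: grid_event_def R_def mult.commute)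
  then have "prob (sym_diff (A \<union> B) (grid_event (N * N') R)) \<le> prob (sym_diff A (grid_event N Q) \<union> sym_diff B (grid_event N' Q'))"
    by (intro finite_measure_mono) auto
  also have "\<dots> \<le> prob (sym_diff A (grid_event N Q)) + prob (sym_diff B (grid_event N' Q'))"
    by (rule measure_Un_le) auto
  also have "\<dots> < \<epsilon>" using N N' by simp
  finally show "\<exists>N Q. 0 < N \<and> prob (sym_diff (A \<union> B) (grid_event N Q)) < \<epsilon>" using N N' by (auto intro!: exI[of _ "N * N'"])
qed

lemma approximable_empty: "approximable {}"
  using approximable_grid_event[of 1 "{}"] by (simp add: grid_event_def)

text \<open>
  A countable union is approximated by a finite one by continuity of the measure, and finite unions
  are handled on a common refinement of the grids.
\<close>

lemma approximable_UN:
  fixes A :: "nat \<Rightarrow> 'w set"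
  assumes A: "\<And>n. approximable (A n)" shows "approximable (\<Union>n. A n)"
  unfolding approximable_def
proof (intro conjI allI impI)
  have [measurable]: "A n \<in> sets \<Omega>" for n using approximable_sets[OF A] .
  show "(\<Union>n. A n) \<in> sets \<Omega>" by measurable
  fix \<epsilon> :: real assume \<epsilon>: "0 < \<epsilon>"
  define C where "C n = (\<Union>i<n. A i)" for n
  have C: "approximable (C n)" for n
    by (induction n) (auto simp: C_def lessThan_Suc approximable_empty intro!: approximable_Un A)
  have [measurable]: "C n \<in> sets \<Omega>" for n using approximable_sets[OF C] .
  have UC: "(\<Union>n. C n) = (\<Union>n. A n)" by (auto simp: C_def)
  have "incseq C" unfolding C_def by (intro monoI UN_mono) auto
  then have "(\<lambda>n. prob (C n)) \<longlonglongrightarrow> prob (\<Union>n. C n)"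
    by (intro finite_Lim_measure_incseq) auto
  then have "\<forall>\<^sub>F n in sequentially. dist (prob (C n)) (prob (\<Union>n. A n)) < \<epsilon> / 2"
    unfolding UC using \<epsilon> by (intro tendstoD) auto
  then obtain n where n: "dist (prob (C n)) (prob (\<Union>n. A n)) < \<epsilon> / 2" by (auto simp: eventually_sequentially)
  obtain N Q where N: "0 < N" "prob (sym_diff (C n) (grid_event N Q)) < \<epsilon> / 2"
    using C[of n] \<epsilon> by (auto simp: approximable_def dest: spec[of _ "\<epsilon> / 2"])
  have sub: "C n \<subseteq> (\<Union>n. A n)" by (auto simp: C_def)
  have "prob (sym_diff (\<Union>n. A n) (grid_event N Q)) \<le> prob (((\<Union>n. A n) - C n) \<union> sym_diff (C n) (grid_event N Q))"
    using sub by (intro finite_measure_mono) auto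
  also have "\<dots> \<le> prob ((\<Union>n. A n) - C n) + prob (sym_diff (C n) (grid_event N Q))"
    by (rule measure_Un_le) auto
  also have "prob ((\<Union>n. A n) - C n) = prob (\<Union>n. A n) - prob (C n)"
    using sub by (intro finite_measure_Diff) auto
  also have "\<dots> + prob (sym_diff (C n) (grid_event N Q)) < \<epsilon>" using N n unfolding dist_real_def by linarith
  finally show "\<exists>N Q. 0 < N \<and> prob (sym_diff (\<Union>n. A n) (grid_event N Q)) < \<epsilon>" using N by auto
qed

lemma approximable_cong_AE:
  assumes B: "approximable B" and A: "A \<in> sets \<Omega>" and ae: "AE \<omega> in \<Omega>. \<omega> \<in> A \<longleftrightarrow> \<omega> \<in> B"
  shows "approximable A"
proof -
  note [measurable] = approximable_sets[OF B] A
  have "prob (sym_diff A (grid_event N Q)) = prob (sym_diff B (grid_event N Q))" for N Q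
    using ae by (intro finite_measure_eq_AE) auto
  then show ?thesis using B A by (simp add: approximable_def)
qed

definition approx_algebra :: "'w measure" where
  "approx_algebra = sigma (space \<Omega>) {B. approximable B}"

lemma space_approx_algebra [simp]: "space approx_algebra = space \<Omega>"
  by (simp add: approx_algebra_def space_measure_of_conv)

lemma sets_approx_algebra: "sets approx_algebra = {B. approximable B}"
proof -
  have "sigma_algebra (space \<Omega>) {B. approximable B}"
    unfolding sigma_algebra_iff2
  proof (intro conjI ballI allI impI)
    show "{B. approximable B} \<subseteq> Pow (space \<Omega>)" using approximable_sets sets.sets_into_space by auto
  qed (auto intro!: approximable_compl approximable_empty approximable_UN)
  then show ?thesis unfolding approx_algebra_def by (rule sigma_algebra.sets_measure_of_eq)
qed

lemma measurable_approx_\<xi>_Ioc: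
  assumes "a \<in> \<rat>" "b \<in> \<rat>"
  shows "(\<lambda>\<omega>. cnt (\<xi> \<omega>) {a<..b}) \<in> approx_algebra \<rightarrow>\<^sub>M count_space UNIV"
proof (cases "a \<le> b")
  case True
  obtain N p q :: nat where N: "0 < N" "p \<le> q" "q \<le> 2 * N * N"
    "a = - real N + real p * (1 / real N)" "b = - real N + real q * (1 / real N)"
    using Rats_common_grid[OF assms True] by blast
  have eq: "cnt (\<xi> \<omega>) {a<..b} = (\<Sum>j\<in>{p..<q}. grid N \<omega> ! j)" if "\<omega> \<in> space \<Omega>" for \<omega>
    unfolding N(4,5) grid_def using N by (intro cnt_Ioc_counts[OF that]) auto
  show ?thesis
  proof (subst measurable_count_space_eq2_countable, safe)
    fix k
    have "(\<lambda>\<omega>. cnt (\<xi> \<omega>) {a<..b}) -` {k} \<inter> space approx_algebra = grid_event N {v. (\<Sum>j\<in>{p..<q}. v ! j) = k}"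
      using eq by (auto simp: grid_event_def)
    then show "(\<lambda>\<omega>. cnt (\<xi> \<omega>) {a<..b}) -` {k} \<inter> space approx_algebra \<in> sets approx_algebra"
      using approximable_grid_event[OF N(1)] by (simp add: sets_approx_algebra)
  qed auto
qed (simp add: cnt_def)

text \<open>
  Almost surely \<open>P\<close> is simple and has the same points as \<open>\<xi>\<close>, so \<open>Suc_le_cnt_iff\<close> expresses counts of \<open>P\<close>
  recursively by counts of \<open>\<xi>\<close>.
\<close>

lemma approximable_le_cnt:
  assumes "a \<in> \<rat>" "b \<in> \<rat>"
  shows "{\<omega> \<in> space \<Omega>. k \<le> cnt (P \<omega>) {a<..b}} \<in> sets approx_algebra"
  using assms
proof (induction k arbitrary: b)
  case 0
  then show ?case using sets.top[of approx_algebra] by simp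
next
  case (Suc k)
  let ?D = "{\<omega> \<in> space approx_algebra. \<exists>r\<in>\<rat>. a < r \<and> r < b \<and> \<omega> \<in> {\<omega> \<in> space \<Omega>. k \<le> cnt (P \<omega>) {a<..r}} \<and> 1 \<le> cnt (\<xi> \<omega>) {r<..b}}"
  have "?D \<in> sets approx_algebra"
  proof (rule sets.sets_Collect_countable_Ex'[OF _ countable_rat])
    fix r :: real assume r: "r \<in> \<rat>"
    note [measurable] = Suc.IH[OF Suc.prems(1) r] measurable_approx_\<xi>_Ioc[OF r Suc.prems(2)]
    show "{\<omega> \<in> space approx_algebra. a < r \<and> r < b \<and> \<omega> \<in> {\<omega> \<in> space \<Omega>. k \<le> cnt (P \<omega>) {a<..r}} \<and> 1 \<le> cnt (\<xi> \<omega>) {r<..b}} \<in> sets approx_algebra"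
      by measurable
  qed
  then have "approximable ?D" by (simp add: sets_approx_algebra)
  then have "approximable {\<omega> \<in> space \<Omega>. Suc k \<le> cnt (P \<omega>) {a<..b}}"
  proof (rule approximable_cong_AE)
    show "{\<omega> \<in> space \<Omega>. Suc k \<le> cnt (P \<omega>) {a<..b}} \<in> sets \<Omega>" by measurable
    show "AE \<omega> in \<Omega>. \<omega> \<in> {\<omega> \<in> space \<Omega>. Suc k \<le> cnt (P \<omega>) {a<..b}} \<longleftrightarrow> \<omega> \<in> ?D"
      using AE_simple AE_marks_positive AE_space
    proof eventually_elim
      case (elim \<omega>)
      then show ?case using Suc_le_cnt_iff[OF P_config \<xi>_config, of \<omega> \<omega> k a b] by simp
    qed
  qed
  then show ?case by (simp add: sets_approx_algebra)
qed

lemma measurable_approx_P_Ioc: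
  assumes "a \<in> \<rat>" "b \<in> \<rat>"
  shows "(\<lambda>\<omega>. cnt (P \<omega>) {a<..b}) \<in> approx_algebra \<rightarrow>\<^sub>M count_space UNIV"
proof (subst measurable_count_space_eq2_countable, safe)
  fix k
  have "(\<lambda>\<omega>. cnt (P \<omega>) {a<..b}) -` {k} \<inter> space approx_algebra =
    {\<omega> \<in> space \<Omega>. k \<le> cnt (P \<omega>) {a<..b}} - {\<omega> \<in> space \<Omega>. Suc k \<le> cnt (P \<omega>) {a<..b}}" by auto
  then show "(\<lambda>\<omega>. cnt (P \<omega>) {a<..b}) -` {k} \<inter> space approx_algebra \<in> sets approx_algebra"
    using approximable_le_cnt[OF assms] by (simp add: sets.Diff)
qed auto

lemma measurable_approx_P: "P \<in> approx_algebra \<rightarrow>\<^sub>M real_configs"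
proof (rule measurable_real_configs_rational)
  fix a b :: real assume [measurable]: "a \<in> \<rat>" "b \<in> \<rat>"
  note [measurable] = measurable_approx_P_Ioc[OF this]
  have "(\<lambda>\<omega>. of_nat (cnt (P \<omega>) {a<..b}) :: ennreal) \<in> borel_measurable approx_algebra" by measurable
  then show "(\<lambda>\<omega>. emeasure (P \<omega>) {a<..b}) \<in> borel_measurable approx_algebra"
    by (rule measurable_cong[THEN iffD1, rotated]) (simp add: real_configs_Ioc(1)[OF P_config])
qed (simp add: P_config)

lemma measurable_approx_\<xi>: "\<xi> \<in> approx_algebra \<rightarrow>\<^sub>M real_configs"
proof (rule measurable_real_configs_rational)
  fix a b :: real assume [measurable]: "a \<in> \<rat>" "b \<in> \<rat>"
  note [measurable] = measurable_approx_\<xi>_Ioc[OF this]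
  have "(\<lambda>\<omega>. of_nat (cnt (\<xi> \<omega>) {a<..b}) :: ennreal) \<in> borel_measurable approx_algebra" by measurable
  then show "(\<lambda>\<omega>. emeasure (\<xi> \<omega>) {a<..b}) \<in> borel_measurable approx_algebra"
    by (rule measurable_cong[THEN iffD1, rotated]) (simp add: real_configs_Ioc(1)[OF \<xi>_config])
qed (simp add: \<xi>_config)

lemma approximable_factor:
  assumes fac: "is_factor \<Omega> P \<xi> M" and M: "M \<in> \<Omega> \<rightarrow>\<^sub>M uprod_configs" and S: "S \<in> sets uprod_configs"
  shows "approximable {\<omega> \<in> space \<Omega>. M \<omega> \<in> S}"
proof -
  obtain F where F: "F \<in> real_configs \<Otimes>\<^sub>M real_configs \<rightarrow>\<^sub>M uprod_configs" and ae: "AE \<omega> in \<Omega>. M \<omega> = F (P \<omega>, \<xi> \<omega>)"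
    using fac unfolding is_factor_def by blast
  have "(\<lambda>\<omega>. F (P \<omega>, \<xi> \<omega>)) \<in> approx_algebra \<rightarrow>\<^sub>M uprod_configs"
    by (rule measurable_compose[OF measurable_Pair[OF measurable_approx_P measurable_approx_\<xi>] F])
  from measurable_sets[OF this S]
  have "approximable ((\<lambda>\<omega>. F (P \<omega>, \<xi> \<omega>)) -` S \<inter> space \<Omega>)" by (simp add: sets_approx_algebra)
  then show ?thesis
  proof (rule approximable_cong_AE)
    have "M -` S \<inter> space \<Omega> \<in> sets \<Omega>" by (rule measurable_sets[OF M S])
    also have "M -` S \<inter> space \<Omega> = {\<omega> \<in> space \<Omega>. M \<omega> \<in> S}" by auto
    finally show "{\<omega> \<in> space \<Omega>. M \<omega> \<in> S} \<in> sets \<Omega>" .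
    show "AE \<omega> in \<Omega>. \<omega> \<in> {\<omega> \<in> space \<Omega>. M \<omega> \<in> S} \<longleftrightarrow> \<omega> \<in> (\<lambda>\<omega>. F (P \<omega>, \<xi> \<omega>)) -` S \<inter> space \<Omega>"
      using ae by eventually_elim auto
  qed
qed

text \<open>
  A factor is, up to null sets, measurable with respect to the approximable events; it remains to
  approximate the two level sets \<open>y = 1\<close> and \<open>y = -1\<close> on a common grid.
\<close>

lemma factor_sign_approx:
  fixes y :: "real uprod measure \<Rightarrow> real"
  assumes fac: "is_factor \<Omega> P \<xi> M" and M: "M \<in> \<Omega> \<rightarrow>\<^sub>M uprod_configs"
    and y: "y \<in> borel_measurable uprod_configs" "\<And>N. y N \<in> {-1, 0, 1}" and \<epsilon>: "0 < \<epsilon>"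
  obtains N \<psi> where "0 < N" "\<And>v. \<bar>\<psi> v\<bar> \<le> (1::real)" "expectation (\<lambda>\<omega>. \<bar>y (M \<omega>) - \<psi> (grid N \<omega>)\<bar>) \<le> \<epsilon>"
proof -
  define B where "B c = {\<omega> \<in> space \<Omega>. M \<omega> \<in> {N \<in> space uprod_configs. y N = c}}" for c
  have B: "approximable (B c)" for c
    unfolding B_def using y(1) by (intro approximable_factor[OF fac M]) measurable
  note [measurable] = approximable_sets[OF B]
  have ex: "\<exists>N Q. 0 < N \<and> prob (sym_diff (B c) (grid_event N Q)) < \<epsilon> / 2" for c
    using B[of c, unfolded approximable_def, THEN conjunct2] half_gt_zero[OF \<epsilon>] by blast
  obtain N Q where N: "0 < N" "prob (sym_diff (B 1) (grid_event N Q)) < \<epsilon> / 2" using ex by blast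
  obtain N' Q' where N': "0 < N'" "prob (sym_diff (B (-1)) (grid_event N' Q')) < \<epsilon> / 2" using ex by blast
  obtain h where h: "\<forall>\<omega>\<in>space \<Omega>. grid N \<omega> = h (grid (N * N') \<omega>)" using grid_refine N N' by blast
  obtain h' where h': "\<forall>\<omega>\<in>space \<Omega>. grid N' \<omega> = h' (grid (N * N') \<omega>)"
    using grid_refine[OF N'(1) N(1)] by (auto simp: mult.commute)
  define \<psi> where "\<psi> v = (indicator Q (h v) - indicator Q' (h' v) :: real)" for v
  have [measurable]: "(\<lambda>\<omega>. y (M \<omega>)) \<in> borel_measurable \<Omega>" by (rule measurable_compose[OF M y(1)])
  have [measurable]: "(\<lambda>\<omega>. \<psi> (grid (N * N') \<omega>)) \<in> borel_measurable \<Omega>"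
    by (rule measurable_compose[OF measurable_grid]) simp
  have bound: "\<bar>y (M \<omega>) - \<psi> (grid (N * N') \<omega>)\<bar> \<le>
      indicator (sym_diff (B 1) (grid_event N Q)) \<omega> + indicator (sym_diff (B (-1)) (grid_event N' Q')) \<omega>"
    if \<omega>: "\<omega> \<in> space \<Omega>" for \<omega>
  proof -
    have "M \<omega> \<in> space uprod_configs" using measurable_space[OF M \<omega>] .
    then have "\<omega> \<in> B c \<longleftrightarrow> y (M \<omega>) = c" for c using \<omega> by (simp add: B_def)
    moreover have "\<psi> (grid (N * N') \<omega>) = indicator (grid_event N Q) \<omega> - indicator (grid_event N' Q') \<omega>"
      using h h' \<omega> by (simp add: \<psi>_def grid_event_def indicator_def)
    moreover have "indicator (sym_diff X Z) \<omega> = \<bar>indicator X \<omega> - indicator Z \<omega> :: real\<bar>" for X Z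
      by (simp add: indicator_def)
    moreover have "y (M \<omega>) = indicator (B 1) \<omega> - indicator (B (-1)) \<omega>"
      using y(2)[of "M \<omega>"] calculation(1) by (auto simp: indicator_def)
    ultimately show ?thesis by (simp only:)
  qed
  have "expectation (\<lambda>\<omega>. \<bar>y (M \<omega>) - \<psi> (grid (N * N') \<omega>)\<bar>) \<le>
      expectation (\<lambda>\<omega>. indicator (sym_diff (B 1) (grid_event N Q)) \<omega> + indicator (sym_diff (B (-1)) (grid_event N' Q')) \<omega>)"
  proof (rule integral_mono_AE)
    show int: "integrable \<Omega> (\<lambda>\<omega>. indicat_real (sym_diff (B 1) (grid_event N Q)) \<omega> + indicator (sym_diff (B (-1)) (grid_event N' Q')) \<omega>)"
      by (intro Bochner_Integration.integrable_add integrable_real_indicator) (auto simp: emeasure_eq_measure)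
    show "integrable \<Omega> (\<lambda>\<omega>. \<bar>y (M \<omega>) - \<psi> (grid (N * N') \<omega>)\<bar>)"
      by (rule Bochner_Integration.integrable_bound[OF int]) (use bound in \<open>auto intro!: AE_I2\<close>)
  qed (use bound in \<open>auto intro!: AE_I2\<close>)
  also have "\<dots> = prob (sym_diff (B 1) (grid_event N Q)) + prob (sym_diff (B (-1)) (grid_event N' Q'))"
    by (subst Bochner_Integration.integral_add) (auto simp: emeasure_eq_measure intro!: integrable_real_indicator)
  also have "\<dots> \<le> \<epsilon>" using N N' by simp
  finally have "expectation (\<lambda>\<omega>. \<bar>y (M \<omega>) - \<psi> (grid (N * N') \<omega>)\<bar>) \<le> \<epsilon>" .
  moreover have "\<bar>\<psi> v\<bar> \<le> 1" for v by (auto simp: \<psi>_def indicator_def)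
  ultimately show ?thesis using that[of "N * N'" \<psi>] N N' by simp
qed

end

section \<open>Parity of the number of crossing edges\<close>

text \<open>
  The generating family of \<open>uprod_borel\<close> is already a sigma-algebra, being the final one for the
  quotient map from the plane.
\<close>

lemma sets_uprod_borel:
  "A \<in> sets uprod_borel \<longleftrightarrow> {(x, y). Upair x y \<in> A} \<in> sets borel"
proof -
  have "sigma_algebra UNIV {A. {(x, y). Upair x y \<in> A} \<in> sets (borel :: (real \<times> real) measure)}"
    unfolding sigma_algebra_iff2
  proof (intro conjI ballI allI impI)
    fix s :: "real uprod set" assume "s \<in> {A. {(x, y). Upair x y \<in> A} \<in> sets borel}"
    moreover have "{(x, y). Upair x y \<in> UNIV - s} = UNIV - {(x, y). Upair x y \<in> s}" by auto
    ultimately show "UNIV - s \<in> {A. {(x, y). Upair x y \<in> A} \<in> sets borel}" by auto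
  next
    fix A :: "nat \<Rightarrow> real uprod set" assume "range A \<subseteq> {A. {(x, y). Upair x y \<in> A} \<in> sets borel}"
    moreover have "{(x, y). Upair x y \<in> \<Union>(range A)} = (\<Union>i. {(x, y). Upair x y \<in> A i})" by auto
    ultimately show "\<Union>(range A) \<in> {A. {(x, y). Upair x y \<in> A} \<in> sets borel}" by auto
  qed auto
  from sigma_algebra.sets_measure_of_eq[OF this] show ?thesis unfolding uprod_borel_def by auto
qed

lemma space_uprod_borel [simp]: "space uprod_borel = UNIV"
  by (simp add: uprod_borel_def space_measure_of_conv)

abbreviation pair_window :: "nat \<Rightarrow> real uprod set" where
  "pair_window \<equiv> \<lambda>n. {e. set_uprod e \<subseteq> {- real n .. real n}}"

definition touching :: "real set \<Rightarrow> real uprod set" where "touching A = {e. set_uprod e \<inter> A \<noteq> {}}"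

definition contained :: "real set \<Rightarrow> real uprod set" where "contained A = {e. set_uprod e \<subseteq> A}"

text \<open>
  In contrast to \<open>crosses\<close>, the left endpoint may coincide with \<open>z\<close>. With this convention the numbers
  of edges that cross \<open>s\<close> and \<open>t\<close> differ, modulo 2, exactly by the stubs in \<open>{s<..t}\<close>, whether or not
  \<open>s\<close> or \<open>t\<close> is a point.
\<close>

definition crossing :: "real \<Rightarrow> real uprod set" where "crossing z = {e. \<exists>x y. e = Upair x y \<and> x \<le> z \<and> z < y}"

lemma Upair_touching [simp]: "Upair x y \<in> touching A \<longleftrightarrow> x \<in> A \<or> y \<in> A" by (auto simp: touching_def)

lemma Upair_contained [simp]: "Upair x y \<in> contained A \<longleftrightarrow> x \<in> A \<and> y \<in> A" by (auto simp: contained_def)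

lemma Upair_crossing [simp]: "Upair x y \<in> crossing z \<longleftrightarrow> x \<le> z \<and> z < y \<or> y \<le> z \<and> z < x"
  by (auto simp: crossing_def)

lemma sets_touching [simp]: "A \<in> sets borel \<Longrightarrow> touching A \<in> sets uprod_borel"
proof -
  assume A: "A \<in> sets borel"
  have "{(x, y). Upair x y \<in> touching A} = A \<times> UNIV \<union> UNIV \<times> A" by auto
  also have "\<dots> \<in> sets borel" using A by (intro sets.Un borel_Times) auto
  finally show ?thesis by (simp add: sets_uprod_borel)
qed

lemma sets_contained [simp]: "A \<in> sets borel \<Longrightarrow> contained A \<in> sets uprod_borel"
proof -
  assume A: "A \<in> sets borel"
  have "{(x, y). Upair x y \<in> contained A} = A \<times> A" by auto
  also have "\<dots> \<in> sets borel" using A by (intro borel_Times) auto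
  finally show ?thesis by (simp add: sets_uprod_borel)
qed

lemma sets_crossing [simp]: "crossing z \<in> sets uprod_borel"
proof -
  have "{(x, y). Upair x y \<in> crossing z} = {..z} \<times> {z<..} \<union> {z<..} \<times> {..z}" by auto
  also have "\<dots> \<in> sets borel" by (intro sets.Un borel_Times) auto
  finally show ?thesis by (simp add: sets_uprod_borel)
qed

lemma sets_uprod_singleton [simp]: "{e} \<in> sets uprod_borel"
proof (cases e)
  case (Upair a b)
  have "{(x, y). Upair x y \<in> {e}} = {(a, b), (b, a)}" by (auto simp: Upair)
  then show ?thesis by (simp add: sets_uprod_borel)
qed

text \<open>
  The almost sure properties of the edge set \<open>m\<close> in terms of the degree configuration \<open>R\<close>, whose points serve
  as the vertices.
\<close>

definition matching :: "real measure \<Rightarrow> real uprod measure \<Rightarrow> bool" where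
  "matching R m \<longleftrightarrow> R \<in> configs borel window \<and> m \<in> configs uprod_borel pair_window \<and>
     (\<forall>e\<in>point_set m. proper_uprod e \<and> cnt m {e} \<le> 1 \<and> set_uprod e \<subseteq> point_set R) \<and>
     (\<forall>x\<in>point_set R. finite {e \<in> point_set m. x \<in> set_uprod e} \<and>
        cnt R {x} = card {e \<in> point_set m. x \<in> set_uprod e})"

lemma matching_emeasure:
  assumes m: "matching R m" and A: "A \<in> sets uprod_borel"
  shows "emeasure m A = emeasure (count_space UNIV) (point_set m \<inter> A)"
proof (rule configs_simple_emeasure[OF _ sets_uprod_singleton A])
  show c: "m \<in> configs uprod_borel pair_window" using m by (simp add: matching_def)
  show "cnt m {e} \<le> 1" for e
    using m configs_point_set[OF c sets_uprod_singleton, of e] by (cases "e \<in> point_set m") (auto simp: matching_def)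
qed

lemma matching_cnt:
  assumes m: "matching R m" and A: "A \<in> sets uprod_borel" and fin: "finite (point_set m \<inter> A)"
  shows "cnt m A = card (point_set m \<inter> A)"
  using matching_emeasure[OF m A] fin by (intro cnt_eq) simp

lemma matching_finite_touching:
  assumes m: "matching R m" shows "finite (point_set m \<inter> touching {a<..b})"
proof -
  have R: "R \<in> configs borel window" using m by (simp add: matching_def)
  have "point_set m \<inter> touching {a<..b} \<subseteq> (\<Union>x\<in>point_set R \<inter> {a<..b}. {e \<in> point_set m. x \<in> set_uprod e})"
    using m by (fastforce simp: touching_def matching_def)
  moreover have "finite \<dots>" using m real_configs_Ioc(3)[OF R] by (auto simp: matching_def)
  ultimately show ?thesis by (rule finite_subset)
qed

text \<open>
  Double counting of the incidences between edges and points in \<open>{a<..b}\<close>. The set \<open>H\<close> may contain further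
  edges, which contribute \<open>0\<close>; this allows different counts to be compared over the same finite set of edges.
\<close>

lemma matching_degree_sum:
  assumes m: "matching R m" and H: "finite H" "H \<subseteq> point_set m" "point_set m \<inter> touching {a<..b} \<subseteq> H"
  shows "cnt R {a<..b} = (\<Sum>e\<in>H. card (set_uprod e \<inter> {a<..b}))"
proof -
  have R: "R \<in> configs borel window" using m by (simp add: matching_def)
  define S where "S = point_set R \<inter> {a<..b}"
  have S: "finite S" unfolding S_def by (rule real_configs_Ioc(3)[OF R])
  have "cnt R {a<..b} = (\<Sum>x\<in>S. cnt R {x})" unfolding S_def by (rule real_configs_Ioc(2)[OF R])
  also have "\<dots> = (\<Sum>x\<in>S. \<Sum>e\<in>H. of_bool (x \<in> set_uprod e))"
  proof (rule sum.cong[OF refl])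
    fix x assume x: "x \<in> S"
    have "{e \<in> point_set m. x \<in> set_uprod e} = H \<inter> {e. x \<in> set_uprod e}"
    proof -
      have "e \<in> touching {a<..b}" if "x \<in> set_uprod e" for e using that x by (auto simp: S_def touching_def)
      then show ?thesis using H(2,3) by blast
    qed
    then show "cnt R {x} = (\<Sum>e\<in>H. of_bool (x \<in> set_uprod e))"
      using m x H(1) by (simp add: matching_def S_def sum.If_cases of_bool_def)
  qed
  also have "\<dots> = (\<Sum>e\<in>H. \<Sum>x\<in>S. of_bool (x \<in> set_uprod e))" by (rule sum.swap)
  also have "\<dots> = (\<Sum>e\<in>H. card (set_uprod e \<inter> {a<..b}))"
  proof (rule sum.cong[OF refl])
    fix e assume "e \<in> H"
    then have "set_uprod e \<inter> {a<..b} = S \<inter> {x. x \<in> set_uprod e}"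
      using m H by (auto simp: S_def matching_def)
    then show "(\<Sum>x\<in>S. of_bool (x \<in> set_uprod e)) = card (set_uprod e \<inter> {a<..b})"
      using S by (simp add: sum.If_cases of_bool_def)
  qed
  finally show ?thesis .
qed

text \<open>
  The number of stubs in \<open>A\<close> as a function of the edges only: an edge with both endpoints in \<open>A\<close> is
  counted twice. Evaluations of \<open>m\<close> at two sets suffice, so measurability and the effect of translations are
  immediate.
\<close>

definition stubs :: "real set \<Rightarrow> real uprod measure \<Rightarrow> nat" where
  "stubs A m = cnt m (touching A) + cnt m (contained A)"

lemma card_endpoints:
  assumes "proper_uprod e"
  shows "card (set_uprod e \<inter> A) = of_bool (e \<in> touching A) + of_bool (e \<in> contained A)"
proof (cases e)
  case (Upair x y)
  then have "x \<noteq> y" using assms by simp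
  then show ?thesis unfolding Upair by (cases "x \<in> A"; cases "y \<in> A") auto
qed

lemma matching_stubs:
  assumes m: "matching R m" shows "cnt R {a<..b} = stubs {a<..b} m"
proof -
  let ?H = "point_set m \<inter> touching {a<..b}"
  have fin: "finite ?H" by (rule matching_finite_touching[OF m])
  have "contained {a<..b} \<subseteq> touching {a<..b}"
  proof
    fix e assume "e \<in> contained {a<..b}" then show "e \<in> touching {a<..b}" by (cases e) auto
  qed
  then have inn: "point_set m \<inter> contained {a<..b} = ?H \<inter> contained {a<..b}" by auto
  have "cnt R {a<..b} = (\<Sum>e\<in>?H. card (set_uprod e \<inter> {a<..b}))"
    using fin by (intro matching_degree_sum[OF m]) auto
  also have "\<dots> = (\<Sum>e\<in>?H. 1 + of_bool (e \<in> contained {a<..b}))"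
  proof (rule sum.cong[OF refl])
    fix e assume "e \<in> ?H"
    then show "card (set_uprod e \<inter> {a<..b}) = 1 + of_bool (e \<in> contained {a<..b})"
      using m by (subst card_endpoints) (auto simp: matching_def)
  qed
  also have "\<dots> = card ?H + (\<Sum>e\<in>?H. of_bool (e \<in> contained {a<..b}))" unfolding sum.distrib by simp
  also have "(\<Sum>e\<in>?H. of_bool (e \<in> contained {a<..b})) = card (?H \<inter> contained {a<..b})"
    using fin by (simp add: of_bool_def sum.If_cases)
  also have "\<dots> = cnt m (contained {a<..b})"
    using fin by (subst matching_cnt[OF m]) (auto simp: inn)
  also have "card ?H = cnt m (touching {a<..b})" using fin by (subst matching_cnt[OF m]) auto
  finally show ?thesis by (simp add: stubs_def)
qed

text \<open>
  Whether an edge crosses \<open>z\<close> is, modulo 2, the number of its endpoints in \<open>{..z}\<close>.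
\<close>

lemma edge_parity:
  assumes "proper_uprod e" "s \<le> t"
  shows "even (of_bool (e \<in> crossing s) + of_bool (e \<in> crossing t) + card (set_uprod e \<inter> {s<..t}))"
proof (cases e)
  case (Upair x y)
  have "x \<noteq> y" using assms Upair by simp
  then have "card (set_uprod e \<inter> {s<..t}) = of_bool (x \<in> {s<..t}) + of_bool (y \<in> {s<..t})"
    unfolding Upair by (cases "x \<in> {s<..t}"; cases "y \<in> {s<..t}") auto
  then show ?thesis using assms(2) by (auto simp: Upair)
qed

lemma crossing_subset:
  "crossing s \<subseteq> crossing t \<union> touching {min s t<..max s t}"
proof
  fix e assume "e \<in> crossing s"
  then show "e \<in> crossing t \<union> touching {min s t<..max s t}"
    by (cases e) auto
qed

lemma matching_finite_crossing:
  assumes m: "matching R m" and fin: "finite (point_set m \<inter> crossing s)"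
  shows "finite (point_set m \<inter> crossing t)"
  by (rule finite_subset[OF _ finite_UnI[OF fin matching_finite_touching[OF m, of "min t s" "max t s"]]])
    (use crossing_subset[of t s] in auto)

text \<open>
  Sum the parities of the single edges over the finitely many edges that cross \<open>s\<close> or \<open>t\<close> or have an endpoint
  in between.
\<close>

lemma matching_crossing_parity:
  assumes m: "matching R m" and st: "s \<le> t" and fin: "finite (point_set m \<inter> crossing s)"
  shows "even (card (point_set m \<inter> crossing s) + card (point_set m \<inter> crossing t) + cnt R {s<..t})"
proof -
  define H where "H = point_set m \<inter> (crossing s \<union> crossing t \<union> touching {s<..t})"
  have H: "finite H" unfolding H_def Int_Un_distrib
    using fin matching_finite_crossing[OF m fin] matching_finite_touching[OF m] by simp
  have c: "card (point_set m \<inter> crossing z) = (\<Sum>e\<in>H. of_bool (e \<in> crossing z))" if "z = s \<or> z = t" for z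
  proof -
    have "point_set m \<inter> crossing z = H \<inter> crossing z" using that by (auto simp: H_def)
    then show ?thesis using H by (simp add: of_bool_def sum.If_cases)
  qed
  have d: "cnt R {s<..t} = (\<Sum>e\<in>H. card (set_uprod e \<inter> {s<..t}))"
    by (rule matching_degree_sum[OF m H]) (auto simp: H_def)
  have "card (point_set m \<inter> crossing s) + card (point_set m \<inter> crossing t) + cnt R {s<..t} =
    (\<Sum>e\<in>H. of_bool (e \<in> crossing s) + of_bool (e \<in> crossing t) + card (set_uprod e \<inter> {s<..t}))"
    using c[of s] c[of t] d by (simp add: sum.distrib)
  also have "even \<dots>"
    using m by (intro dvd_sum edge_parity st) (auto simp: H_def matching_def)
  finally show ?thesis .
qed

definition crossing_sign :: "real \<Rightarrow> real uprod measure \<Rightarrow> real" where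
  "crossing_sign z m = (if emeasure m (crossing z) = \<infinity> then 0 else (-1) ^ cnt m (crossing z))"

lemma crossing_sign_range: "crossing_sign z m \<in> {-1, 0, 1}"
  by (cases "even (cnt m (crossing z))") (auto simp: crossing_sign_def)

lemma abs_crossing_sign_le: "\<bar>crossing_sign z m\<bar> \<le> 1"
  using crossing_sign_range[of z m] by auto

lemma matching_crossing_sign:
  assumes m: "matching R m"
  shows "crossing_sign z m = (if finite (point_set m \<inter> crossing z) then (-1) ^ card (point_set m \<inter> crossing z) else 0)"
  using matching_emeasure[OF m, of "crossing z"] matching_cnt[OF m, of "crossing z"]
  by (auto simp: crossing_sign_def)

text \<open>
  The identity behind the proof: the two crossing signs determine each other through the stubs in between,
  and finiteness of the number of crossing edges does not depend on the site.
\<close>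

lemma crossing_sign_product:
  assumes m: "matching R m" and st: "s \<le> t"
  shows "crossing_sign s m * crossing_sign t m * (-1) ^ cnt R {s<..t} = \<bar>crossing_sign s m\<bar>"
proof (cases "finite (point_set m \<inter> crossing s)")
  case True
  then show ?thesis
    using matching_crossing_parity[OF m st True] matching_finite_crossing[OF m True, of t]
    by (simp add: matching_crossing_sign[OF m] power_abs flip: power_add)
next
  case False
  then show ?thesis by (simp add: matching_crossing_sign[OF m])
qed

lemma measurable_crossing_sign: "crossing_sign z \<in> borel_measurable uprod_configs"
proof -
  have [measurable]: "(\<lambda>m. emeasure m (crossing z)) \<in> borel_measurable uprod_configs"
    by (rule measurable_config_eval) simp
  have [measurable]: "(\<lambda>m. cnt m (crossing z)) \<in> uprod_configs \<rightarrow>\<^sub>M count_space UNIV"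
    by (rule measurable_cnt) measurable
  show ?thesis unfolding crossing_sign_def by measurable
qed

section \<open>Translation of edge configurations\<close>

definition translate :: "real \<Rightarrow> real uprod measure \<Rightarrow> real uprod measure" where
  "translate t m = distr m uprod_borel (map_uprod (\<lambda>x. x + t))"

lemma measurable_map_uprod_translate: "map_uprod (\<lambda>x. x + t) \<in> uprod_borel \<rightarrow>\<^sub>M uprod_borel"
proof (rule measurableI)
  fix A assume "A \<in> sets uprod_borel"
  then have [measurable]: "{(x, y). Upair x y \<in> A} \<in> sets borel" by (simp add: sets_uprod_borel)
  have "(\<lambda>(x, y). (x + t, y + t)) -` {(x, y). Upair x y \<in> A} \<inter> space borel \<in> sets (borel :: (real \<times> real) measure)"
    by (rule measurable_sets[OF borel_measurable_continuous_onI]) (auto intro!: continuous_intros simp: case_prod_beta)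
  also have "(\<lambda>(x, y). (x + t, y + t)) -` {(x, y). Upair x y \<in> A} \<inter> space borel =
     {(x, y). Upair x y \<in> map_uprod (\<lambda>x. x + t) -` A \<inter> space uprod_borel}" by auto
  finally show "map_uprod (\<lambda>x. x + t) -` A \<inter> space uprod_borel \<in> sets uprod_borel"
    unfolding sets_uprod_borel .
qed simp

lemma emeasure_translate:
  assumes m: "m \<in> configs uprod_borel pair_window" and A: "A \<in> sets uprod_borel"
  shows "emeasure (translate t m) A = emeasure m (map_uprod (\<lambda>x. x + t) -` A)"
proof -
  have s: "sets m = sets uprod_borel" using m by (auto simp: configs_def)
  then have "space m = UNIV" using sets_eq_imp_space_eq[OF s] by simp
  moreover have "map_uprod (\<lambda>x. x + t) \<in> m \<rightarrow>\<^sub>M uprod_borel"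
    using measurable_map_uprod_translate by (simp add: measurable_cong_sets[OF s refl])
  ultimately show ?thesis unfolding translate_def using A by (simp add: emeasure_distr)
qed

lemma map_uprod_translate_inverse: "map_uprod (\<lambda>x. x - t) (map_uprod (\<lambda>x. x + t) e) = (e :: real uprod)"
  "map_uprod (\<lambda>x. x + t) (map_uprod (\<lambda>x. x - t) e) = (e :: real uprod)"
  by (cases e; simp)+

text \<open>
  Translation by \<open>t\<close> moves the multiplicities along, and it maps a bounded window into a window larger
  by \<open>\<bar>t\<bar>\<close>.
\<close>

lemma translate_config:
  assumes m: "m \<in> configs uprod_borel pair_window" shows "translate t m \<in> configs uprod_borel pair_window"
  unfolding configs_def
proof (intro CollectI conjI allI)
  let ?f = "map_uprod (\<lambda>x. x + t)" and ?g = "map_uprod (\<lambda>x. x - t)"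
  show "sets (translate t m) = sets uprod_borel" by (simp add: translate_def)
  obtain c :: "real uprod \<Rightarrow> nat" where c: "\<forall>A \<in> sets uprod_borel. emeasure m A = (\<integral>\<^sup>+ x. of_nat (c x) \<partial>count_space A)"
    using m by (auto simp: configs_def)
  have "emeasure (translate t m) A = (\<integral>\<^sup>+ x. of_nat (c (?g x)) \<partial>count_space A)" if A: "A \<in> sets uprod_borel" for A
  proof -
    have "?f -` A \<in> sets uprod_borel" using measurable_sets[OF measurable_map_uprod_translate A] by simp
    then have "emeasure (translate t m) A = (\<integral>\<^sup>+ x. of_nat (c x) \<partial>count_space (?f -` A))"
      using emeasure_translate[OF m A] c by simp
    also have "\<dots> = (\<integral>\<^sup>+ x. of_nat (c (?g (?f x))) \<partial>count_space (?f -` A))"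
      by (simp add: map_uprod_translate_inverse)
    also have "\<dots> = (\<integral>\<^sup>+ x. of_nat (c (?g x)) \<partial>count_space A)"
      by (rule nn_integral_bij_count_space)
        (auto intro!: bij_betwI[where g = ?g] simp: map_uprod_translate_inverse)
    finally show ?thesis .
  qed
  then show "\<exists>c. \<forall>A\<in>sets uprod_borel. emeasure (translate t m) A = (\<integral>\<^sup>+ x. of_nat (c x) \<partial>count_space A)"
    by (intro exI[of _ "\<lambda>x. c (?g x)"] ballI)
  fix n
  obtain k where k: "real n + \<bar>t\<bar> \<le> real k" using real_arch_simple by blast
  have K: "pair_window n = contained {- real n..real n}" for n by (simp add: contained_def)
  have "?f -` pair_window n \<subseteq> pair_window k"
  proof
    fix e assume "e \<in> ?f -` pair_window n" then show "e \<in> pair_window k" using k by (cases e) auto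
  qed
  then have "emeasure m (?f -` pair_window n) < \<infinity>"
    by (rule configs_mono[OF m]) (simp add: K)
  then show "emeasure (translate t m) (pair_window n) < \<infinity>" by (subst emeasure_translate[OF m]) (simp_all add: K)
qed

lemma measurable_translate: "translate t \<in> uprod_configs \<rightarrow>\<^sub>M uprod_configs"
proof (rule measurable_config_algebra)
  fix A assume A: "A \<in> sets uprod_borel"
  have "map_uprod (\<lambda>x. x + t) -` A \<in> sets uprod_borel"
    using measurable_sets[OF measurable_map_uprod_translate A] by simp
  then have "(\<lambda>m. emeasure m (map_uprod (\<lambda>x. x + t) -` A)) \<in> borel_measurable uprod_configs"
    by (rule measurable_config_eval)
  then show "(\<lambda>m. emeasure (translate t m) A) \<in> borel_measurable uprod_configs"
    by (rule measurable_cong[THEN iffD1, rotated]) (simp add: emeasure_translate[OF _ A])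
qed (simp add: translate_config)

lemma vimage_map_uprod:
  "map_uprod f -` touching A = touching (f -` A)" "map_uprod f -` contained A = contained (f -` A)"
proof -
  show "map_uprod f -` touching A = touching (f -` A)"
  proof (rule set_eqI)
    fix e show "e \<in> map_uprod f -` touching A \<longleftrightarrow> e \<in> touching (f -` A)" by (cases e) simp
  qed
  show "map_uprod f -` contained A = contained (f -` A)"
  proof (rule set_eqI)
    fix e show "e \<in> map_uprod f -` contained A \<longleftrightarrow> e \<in> contained (f -` A)" by (cases e) simp
  qed
qed

lemma vimage_crossing: "map_uprod (\<lambda>x. x + t) -` crossing z = crossing (z - t)"
proof (rule set_eqI)
  fix e show "e \<in> map_uprod (\<lambda>x. x + t) -` crossing z \<longleftrightarrow> e \<in> crossing (z - t)"
    by (cases e) (auto simp: le_diff_eq diff_less_eq)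
qed

lemma crossing_sign_translate:
  assumes "m \<in> configs uprod_borel pair_window"
  shows "crossing_sign z (translate t m) = crossing_sign (z - t) m"
  by (simp add: crossing_sign_def cnt_def emeasure_translate[OF assms] vimage_crossing)

definition stub_counts :: "real \<Rightarrow> real \<Rightarrow> nat \<Rightarrow> real uprod measure \<Rightarrow> nat list" where
  "stub_counts s w k m = map (\<lambda>i. stubs (cell s w i) m) [0..<k]"

lemma stub_counts_translate:
  assumes "m \<in> configs uprod_borel pair_window"
  shows "stub_counts s w k (translate t m) = stub_counts (s - t) w k m"
proof -
  have "(\<lambda>x. x + t) -` cell s w i = cell (s - t) w i" for i by (auto simp: cell_def)
  then show ?thesis
    by (simp add: stub_counts_def stubs_def cnt_def emeasure_translate[OF assms] vimage_map_uprod)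
qed

lemma measurable_stub_counts: "stub_counts s w k \<in> uprod_configs \<rightarrow>\<^sub>M count_space UNIV"
proof (subst measurable_count_space_eq2_countable, safe)
  fix xs
  have [measurable]: "(\<lambda>m. cnt m (touching (cell s w i))) \<in> uprod_configs \<rightarrow>\<^sub>M count_space UNIV"
    "(\<lambda>m. cnt m (contained (cell s w i))) \<in> uprod_configs \<rightarrow>\<^sub>M count_space UNIV" for i
    by (rule measurable_cnt[OF measurable_config_eval]; simp)+
  have "stub_counts s w k -` {xs} \<inter> space uprod_configs = {m \<in> space uprod_configs. stub_counts s w k m = xs}" by auto
  also have "\<dots> = {m \<in> space uprod_configs. length xs = k \<and> (\<forall>i<k. stubs (cell s w i) m = xs ! i)}"
    by (intro Collect_cong conj_cong refl) (auto simp: stub_counts_def list_eq_iff_nth_eq)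
  also have "\<dots> \<in> sets uprod_configs" unfolding stubs_def by measurable
  finally show "stub_counts s w k -` {xs} \<inter> space uprod_configs \<in> sets uprod_configs" .
qed auto

section \<open>Decorrelation of crossing parities at distant sites\<close>

lemma (in finite_measure) integrable_bounded:
  assumes "f \<in> borel_measurable M" "\<And>x. \<bar>f x\<bar> \<le> (B :: real)"
  shows "integrable M f"
  using assms by (intro integrable_const_bound[where B = B]) auto

context marked_poisson
begin

text \<open>
  The intervals \<open>{- N<..N}\<close> and \<open>{t - N<..t + N}\<close> are separated by a gap of length \<open>k\<close>, that is, by \<open>k * N\<close>
  cells. The sign of the stubs in \<open>{0<..t}\<close> factorises into the signs of \<open>{0<..N}\<close>, of the gap, and of
  \<open>{t - N<..t}\<close>; the outer two are absorbed into the functions of the counts in the two intervals, and the sign of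
  the gap is independent of both.
\<close>

lemma decorrelation:
  fixes \<psi> :: "nat list \<Rightarrow> real" and N k :: nat
  assumes N: "0 < N" and \<psi>: "\<And>v. \<bar>\<psi> v\<bar> \<le> 1"
  defines "w \<equiv> 1 / real N" and "\<rho> \<equiv> measure_pmf.expectation (increment_pmf (1 / real N)) (\<lambda>k. (-1) ^ k)"
  defines "t \<equiv> real (2 * N + k)"
  shows "\<bar>expectation (\<lambda>\<omega>. \<psi> (counts (- real N) w (2 * N * N) \<omega>) * \<psi> (counts (- real N + t) w (2 * N * N) \<omega>) *
     (-1) ^ cnt (\<xi> \<omega>) {0<..t})\<bar> \<le> \<bar>\<rho>\<bar> ^ (k * N)"
proof -
  define m where "m = 2 * N * N"
  define n where "n = k * N"
  let ?E = "\<lambda>n. measure_pmf.expectation (replicate_pmf n (increment_pmf w))"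
  \<comment> \<open>Here \<open>N * N\<close> is the number of cells in half a window, so the exponents count the stubs in
    \<open>{0<..N}\<close> and \<open>{t - N<..t}\<close>.\<close>
  define g where "g v = \<psi> v * (-1) ^ (\<Sum>j\<in>{N * N..<m}. v ! j)" for v
  define h where "h v = \<psi> v * (-1) ^ (\<Sum>j\<in>{0..<N * N}. v ! j)" for v
  define \<sigma> where "\<sigma> v = ((-1) ^ sum_list v :: real)" for v :: "nat list"
  define G where "G v = g (take m v) * (\<sigma> (take n (drop m v)) * h (drop n (drop m v)))" for v
  have w: "0 < w" using N by (simp add: w_def)
  have g1: "\<bar>g v\<bar> \<le> 1" and h1: "\<bar>h v\<bar> \<le> 1" and \<sigma>1: "\<bar>\<sigma> v\<bar> \<le> 1" for v
    using \<psi> by (auto simp: g_def h_def \<sigma>_def abs_mult power_abs)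
  have s1: "- real N + real m * w = real N" using N by (simp add: m_def w_def field_simps)
  have s2: "real N + real n * w = - real N + t" using N by (simp add: n_def w_def t_def field_simps)
  have "\<psi> (counts (- real N) w m \<omega>) * \<psi> (counts (- real N + t) w m \<omega>) * (-1) ^ cnt (\<xi> \<omega>) {0<..t}
      = G (counts (- real N) w (m + (n + m)) \<omega>)" if \<omega>: "\<omega> \<in> space \<Omega>" for \<omega>
  proof -
    let ?V1 = "counts (- real N) w m \<omega>" and ?V2 = "counts (real N) w n \<omega>" and ?V3 = "counts (- real N + t) w m \<omega>"
    have V: "counts (- real N) w (m + (n + m)) \<omega> = ?V1 @ ?V2 @ ?V3"
      unfolding counts_append s1 s2 ..
    have len: "length ?V1 = m" "length ?V2 = n" by (simp_all add: counts_def)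
    have "cnt (\<xi> \<omega>) {0<..t} = cnt (\<xi> \<omega>) {0<..real N} + cnt (\<xi> \<omega>) {real N<..t}"
      by (rule real_configs_Ioc_add[OF \<xi>_config[OF \<omega>]]) (auto simp: t_def)
    also have "cnt (\<xi> \<omega>) {real N<..t} = cnt (\<xi> \<omega>) {real N<..- real N + t} + cnt (\<xi> \<omega>) {- real N + t<..t}"
      by (rule real_configs_Ioc_add[OF \<xi>_config[OF \<omega>]]) (auto simp: t_def)
    also have "cnt (\<xi> \<omega>) {0<..real N} = (\<Sum>j\<in>{N * N..<m}. ?V1 ! j)"
    proof -
      have s0: "- real N + real (N * N) * w = 0" using N by (simp add: w_def)
      show ?thesis using cnt_Ioc_counts[OF \<omega> w, of "N * N" m m "- real N", unfolded s0 s1] by (simp add: m_def)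
    qed
    also have "cnt (\<xi> \<omega>) {real N<..- real N + t} = sum_list ?V2"
      using cnt_Ioc_counts[OF \<omega> w, of 0 n n "real N"] len
      by (simp add: s2 sum.list_conv_set_nth sum_list_sum_nth)
    also have "cnt (\<xi> \<omega>) {- real N + t<..t} = (\<Sum>j\<in>{0..<N * N}. ?V3 ! j)"
    proof -
      have s3: "- real N + t + real (N * N) * w = t" using N by (simp add: w_def)
      show ?thesis using cnt_Ioc_counts[OF \<omega> w, of 0 "N * N" m "- real N + t", unfolded s3] by (simp add: m_def)
    qed
    finally show ?thesis unfolding V by (simp add: G_def g_def h_def \<sigma>_def len power_add)
  qed
  then have "expectation (\<lambda>\<omega>. \<psi> (counts (- real N) w m \<omega>) * \<psi> (counts (- real N + t) w m \<omega>) * (-1) ^ cnt (\<xi> \<omega>) {0<..t})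
      = expectation (\<lambda>\<omega>. G (counts (- real N) w (m + (n + m)) \<omega>))"
    by (rule Bochner_Integration.integral_cong[OF refl])
  also have "\<dots> = ?E (m + (n + m)) G" by (rule expectation_counts[OF w])
  also have "\<dots> = ?E m g * (?E n \<sigma> * ?E m h)"
    unfolding G_def
    by (subst expectation_replicate_pmf_append[OF g1, where g = "\<lambda>v. \<sigma> (take n v) * h (drop n v)"],
        use mult_mono[OF \<sigma>1 h1] in \<open>simp add: abs_mult\<close>,
        subst expectation_replicate_pmf_append[OF \<sigma>1 h1]) simp
  also have "\<bar>\<dots>\<bar> \<le> 1 * (\<bar>\<rho>\<bar> ^ n * 1)"
  proof -
    have b: "\<bar>?E m f\<bar> \<le> 1" if f: "\<And>v. \<bar>f v\<bar> \<le> 1" for f :: "nat list \<Rightarrow> real"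
    proof -
      have "\<bar>?E m f\<bar> \<le> ?E m (\<lambda>v. \<bar>f v\<bar>)" by (rule integral_abs_bound)
      also have "\<dots> \<le> 1"
        by (rule measure_pmf.integral_le_const) (auto intro!: measure_pmf.integrable_const_bound[where B = 1] AE_I2 simp: f)
      finally show ?thesis .
    qed
    have "?E n \<sigma> = \<rho> ^ n" unfolding \<sigma>_def \<rho>_def w_def by (rule expectation_sign_replicate_pmf)
    then show ?thesis unfolding abs_mult by (intro mult_mono b g1 h1) (auto simp: power_abs)
  qed
  finally show ?thesis unfolding m_def n_def by simp
qed

end

locale factor_matching = marked_poisson \<Omega> P \<xi> \<mu>
  for \<Omega> :: "'w measure" and P \<xi> :: "'w \<Rightarrow> real measure" and \<mu> :: "nat pmf" +
  fixes M :: "'w \<Rightarrow> real uprod measure"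
  assumes scheme: "factor_matching_scheme \<Omega> P \<xi> M" and odd: "\<exists>k\<in>set_pmf \<mu>. odd k"
begin

lemma M_measurable: "M \<in> \<Omega> \<rightarrow>\<^sub>M uprod_configs"
  using scheme by (simp add: factor_matching_scheme_def matching_scheme_def)

lemma M_config: "\<omega> \<in> space \<Omega> \<Longrightarrow> M \<omega> \<in> configs uprod_borel pair_window"
  using measurable_space[OF M_measurable] by simp

lemma AE_matching: "AE \<omega> in \<Omega>. matching (\<xi> \<omega>) (M \<omega>)"
proof -
  have "AE \<omega> in \<Omega>. (\<forall>e \<in> point_set (M \<omega>). set_uprod e \<subseteq> point_set (P \<omega>)) \<and>
        (\<forall>x \<in> point_set (P \<omega>). finite {e \<in> point_set (M \<omega>). x \<in> set_uprod e} \<and>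
           emeasure (\<xi> \<omega>) {x} = of_nat (card {e \<in> point_set (M \<omega>). x \<in> set_uprod e}))"
    using scheme unfolding factor_matching_scheme_def matching_scheme_def by blast
  moreover have "AE \<omega> in \<Omega>. \<forall>e \<in> point_set (M \<omega>). proper_uprod e \<and> emeasure (M \<omega>) {e} = 1"
    using scheme unfolding factor_matching_scheme_def simple_scheme_def by blast
  ultimately show ?thesis using AE_marks_positive AE_space
  proof eventually_elim
    case (elim \<omega>)
    have "cnt (M \<omega>) {e} \<le> 1" if "e \<in> point_set (M \<omega>)" for e
      using elim(2) that cnt_eq[of "M \<omega>" "{e}" 1] by simp
    moreover have "cnt (\<xi> \<omega>) {x} = card {e \<in> point_set (M \<omega>). x \<in> set_uprod e}" if "x \<in> point_set (P \<omega>)" for x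
      using elim(1) that by (intro cnt_eq) auto
    ultimately show ?case
      using elim(1,2) \<xi>_config[OF elim(4)] M_config[OF elim(4)]
      unfolding matching_def elim(3)[symmetric] by blast
  qed
qed

text \<open>
  Counts of \<open>\<xi>\<close> are thereby functions of \<open>M\<close>, the object whose law is translation-invariant.
\<close>

lemma AE_counts_eq_stub_counts: "AE \<omega> in \<Omega>. counts s w k \<omega> = stub_counts s w k (M \<omega>)"
  using AE_matching
proof eventually_elim
  case (elim \<omega>)
  show ?case unfolding counts_def stub_counts_def cell_def using matching_stubs[OF elim] by simp
qed

lemma distr_translate: "distr \<Omega> uprod_configs (\<lambda>\<omega>. translate t (M \<omega>)) = distr \<Omega> uprod_configs M"
  using scheme unfolding factor_matching_scheme_def translation_invariant_def translate_def by blast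

lemma measurable_sign [measurable]: "(\<lambda>\<omega>. crossing_sign z (M \<omega>)) \<in> borel_measurable \<Omega>"
  by (rule measurable_compose[OF M_measurable measurable_crossing_sign])

text \<open>
  Both sides are expectations of one functional of the edge configuration, applied to \<open>M\<close> translated by \<open>- t\<close>
  and to \<open>M\<close> itself.
\<close>

lemma expectation_translate:
  fixes \<psi> :: "nat list \<Rightarrow> real"
  shows "expectation (\<lambda>\<omega>. \<bar>crossing_sign t (M \<omega>) - \<psi> (counts (s + t) w k \<omega>)\<bar>) =
    expectation (\<lambda>\<omega>. \<bar>crossing_sign 0 (M \<omega>) - \<psi> (counts s w k \<omega>)\<bar>)"
proof -
  define H where "H m = \<bar>crossing_sign 0 m - \<psi> (stub_counts s w k m)\<bar>" for m
  have H: "H \<in> borel_measurable uprod_configs"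
  proof -
    have [measurable]: "(\<lambda>m. \<psi> (stub_counts s w k m)) \<in> borel_measurable uprod_configs"
      by (rule measurable_compose[OF measurable_stub_counts]) simp
    note [measurable] = measurable_crossing_sign
    show ?thesis unfolding H_def by measurable
  qed
  note [measurable] = measurable_compose[OF M_measurable H]
    measurable_compose[OF M_measurable measurable_compose[OF measurable_translate H]]
  have "expectation (\<lambda>\<omega>. \<bar>crossing_sign t (M \<omega>) - \<psi> (counts (s + t) w k \<omega>)\<bar>) = expectation (\<lambda>\<omega>. H (translate (- t) (M \<omega>)))"
  proof (rule integral_cong_AE)
    show "AE \<omega> in \<Omega>. \<bar>crossing_sign t (M \<omega>) - \<psi> (counts (s + t) w k \<omega>)\<bar> = H (translate (- t) (M \<omega>))"
      using AE_counts_eq_stub_counts[of "s + t" w k] AE_space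
      by eventually_elim (simp add: H_def crossing_sign_translate[OF M_config] stub_counts_translate[OF M_config])
  qed measurable
  also have "\<dots> = integral\<^sup>L (distr \<Omega> uprod_configs (\<lambda>\<omega>. translate (- t) (M \<omega>))) H"
    by (rule integral_distr[OF measurable_compose[OF M_measurable measurable_translate] H, symmetric])
  also have "\<dots> = expectation (\<lambda>\<omega>. H (M \<omega>))"
    unfolding distr_translate by (rule integral_distr[OF M_measurable H])
  also have "\<dots> = expectation (\<lambda>\<omega>. \<bar>crossing_sign 0 (M \<omega>) - \<psi> (counts s w k \<omega>)\<bar>)"
  proof (rule integral_cong_AE)
    show "AE \<omega> in \<Omega>. H (M \<omega>) = \<bar>crossing_sign 0 (M \<omega>) - \<psi> (counts s w k \<omega>)\<bar>"
      using AE_counts_eq_stub_counts[of s w k] by eventually_elim (simp add: H_def)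
  qed measurable
  finally show ?thesis .
qed

text \<open>
  The left-hand side is the expectation of \<open>Y 0 * Y t * (-1) ^ \<xi> {0<..t}\<close> for the crossing signs \<open>Y\<close>.
  Replacing each sign by its approximation costs \<open>\<epsilon>\<close>, and for large \<open>t\<close> the resulting expectation is at
  most \<open>\<epsilon>\<close> by decorrelation.
\<close>

lemma expectation_crossing_sign_le:
  assumes \<epsilon>: "0 < \<epsilon>"
  shows "expectation (\<lambda>\<omega>. \<bar>crossing_sign 0 (M \<omega>)\<bar>) \<le> 3 * \<epsilon>"
proof -
  have fac: "is_factor \<Omega> P \<xi> M" using scheme by (simp add: factor_matching_scheme_def)
  obtain N \<psi> where N: "0 < N" and \<psi>: "\<And>v. \<bar>\<psi> v\<bar> \<le> (1::real)"
    and app: "expectation (\<lambda>\<omega>. \<bar>crossing_sign 0 (M \<omega>) - \<psi> (grid N \<omega>)\<bar>) \<le> \<epsilon>"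
    using factor_sign_approx[OF fac M_measurable measurable_crossing_sign crossing_sign_range \<epsilon>] by blast
  define w where "w = 1 / real N"
  define \<rho> where "\<rho> = measure_pmf.expectation (increment_pmf (1 / real N)) (\<lambda>k. (-1) ^ k :: real)"
  have w: "0 < w" using N by (simp add: w_def)
  obtain l where l: "l \<in> set_pmf \<mu>" "odd l" using odd by blast
  have "\<bar>\<rho>\<bar> < 1" unfolding \<rho>_def
    using N by (intro expectation_sign_less_1[OF increment_pmf_0 _ increment_pmf_single[OF _ l(1)] l(2)]) auto
  then obtain k where k: "\<bar>\<rho>\<bar> ^ k < \<epsilon>" using real_arch_pow_inv[OF \<epsilon>] by blast
  have "\<bar>\<rho>\<bar> ^ (k * N) \<le> \<bar>\<rho>\<bar> ^ k" using \<open>\<bar>\<rho>\<bar> < 1\<close> N by (intro power_decreasing) auto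
  then have small: "\<bar>\<rho>\<bar> ^ (k * N) \<le> \<epsilon>" using k by simp
  \<comment> \<open>The intervals \<open>{- N<..N}\<close> and \<open>{t - N<..t + N}\<close> are then at distance \<open>k\<close>.\<close>
  define t where "t = real (2 * N + k)"
  define a where "a \<omega> = crossing_sign 0 (M \<omega>)" for \<omega>
  define b where "b \<omega> = crossing_sign t (M \<omega>)" for \<omega>
  define a' where "a' \<omega> = \<psi> (counts (- real N) w (2 * N * N) \<omega>)" for \<omega>
  define b' where "b' \<omega> = \<psi> (counts (- real N + t) w (2 * N * N) \<omega>)" for \<omega>
  define S where "S \<omega> = ((-1) ^ cnt (\<xi> \<omega>) {0<..t} :: real)" for \<omega>
  have [measurable]: "a \<in> borel_measurable \<Omega>" "b \<in> borel_measurable \<Omega>" "a' \<in> borel_measurable \<Omega>"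
    "b' \<in> borel_measurable \<Omega>" "S \<in> borel_measurable \<Omega>"
    unfolding a_def b_def a'_def b'_def S_def by measurable
  have bd: "\<bar>a \<omega>\<bar> \<le> 1" "\<bar>b \<omega>\<bar> \<le> 1" "\<bar>a' \<omega>\<bar> \<le> 1" "\<bar>b' \<omega>\<bar> \<le> 1" "\<bar>S \<omega>\<bar> = 1" for \<omega>
    by (auto simp: a_def b_def a'_def b'_def S_def abs_crossing_sign_le \<psi> power_abs)
  have dev: "\<bar>a \<omega> - a' \<omega>\<bar> \<le> 2" "\<bar>b \<omega> - b' \<omega>\<bar> \<le> 2" for \<omega>
    using bd[of \<omega>] by linarith+
  have prod: "\<bar>a' \<omega> * b' \<omega> * S \<omega>\<bar> \<le> 1" for \<omega>
    using mult_mono[OF bd(3,4)[of \<omega>]] bd(5)[of \<omega>] by (simp add: abs_mult)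
  note int = integrable_bounded[of "\<lambda>\<omega>. \<bar>a \<omega> - a' \<omega>\<bar>" 2] integrable_bounded[of "\<lambda>\<omega>. \<bar>b \<omega> - b' \<omega>\<bar>" 2]
    integrable_bounded[of "\<lambda>\<omega>. a' \<omega> * b' \<omega> * S \<omega>" 1] integrable_bounded[of "\<lambda>\<omega>. \<bar>a \<omega>\<bar>" 1]
  have "AE \<omega> in \<Omega>. \<bar>a \<omega>\<bar> \<le> \<bar>a \<omega> - a' \<omega>\<bar> + \<bar>b \<omega> - b' \<omega>\<bar> + a' \<omega> * b' \<omega> * S \<omega>"
    using AE_matching
  proof eventually_elim
    case (elim \<omega>)
    have "0 \<le> t" by (simp add: t_def)
    then have "\<bar>a \<omega>\<bar> = a \<omega> * b \<omega> * S \<omega>"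
      unfolding a_def b_def S_def using crossing_sign_product[OF elim, of 0 t] by simp
    also have "\<dots> = (a \<omega> - a' \<omega>) * b \<omega> * S \<omega> + a' \<omega> * (b \<omega> - b' \<omega>) * S \<omega> + a' \<omega> * b' \<omega> * S \<omega>"
      by (simp add: algebra_simps)
    also have "(a \<omega> - a' \<omega>) * b \<omega> * S \<omega> \<le> \<bar>a \<omega> - a' \<omega>\<bar>"
    proof -
      have "\<bar>(a \<omega> - a' \<omega>) * b \<omega> * S \<omega>\<bar> \<le> \<bar>a \<omega> - a' \<omega>\<bar> * 1"
        unfolding abs_mult bd(5) mult_1_right using bd(2) by (intro mult_left_le) auto
      from order.trans[OF abs_ge_self this] show ?thesis by simp
    qed
    also have "a' \<omega> * (b \<omega> - b' \<omega>) * S \<omega> \<le> \<bar>b \<omega> - b' \<omega>\<bar>"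
    proof -
      have "\<bar>a' \<omega> * (b \<omega> - b' \<omega>) * S \<omega>\<bar> \<le> \<bar>b \<omega> - b' \<omega>\<bar>"
        unfolding abs_mult bd(5) mult_1_right using bd(3) by (intro mult_left_le_one_le) auto
      from order.trans[OF abs_ge_self this] show ?thesis .
    qed
    finally show ?case by simp
  qed
  then have "expectation (\<lambda>\<omega>. \<bar>a \<omega>\<bar>) \<le> expectation (\<lambda>\<omega>. \<bar>a \<omega> - a' \<omega>\<bar> + \<bar>b \<omega> - b' \<omega>\<bar> + a' \<omega> * b' \<omega> * S \<omega>)"
    by (rule integral_mono_AE[rotated 2]) (intro int Bochner_Integration.integrable_add; simp add: bd dev prod)+
  also have "\<dots> = expectation (\<lambda>\<omega>. \<bar>a \<omega> - a' \<omega>\<bar>) + expectation (\<lambda>\<omega>. \<bar>b \<omega> - b' \<omega>\<bar>) + expectation (\<lambda>\<omega>. a' \<omega> * b' \<omega> * S \<omega>)"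
    by (subst Bochner_Integration.integral_add, (intro int Bochner_Integration.integrable_add; simp add: bd dev prod)+)+ simp
  also have "expectation (\<lambda>\<omega>. \<bar>b \<omega> - b' \<omega>\<bar>) = expectation (\<lambda>\<omega>. \<bar>a \<omega> - a' \<omega>\<bar>)"
    unfolding a_def b_def a'_def b'_def by (rule expectation_translate)
  also have "expectation (\<lambda>\<omega>. \<bar>a \<omega> - a' \<omega>\<bar>) \<le> \<epsilon>" using app unfolding a_def a'_def grid_def w_def .
  also have "expectation (\<lambda>\<omega>. a' \<omega> * b' \<omega> * S \<omega>) \<le> \<epsilon>"
    using decorrelation[OF N, of \<psi> k, OF \<psi>] small unfolding a'_def b'_def S_def w_def t_def \<rho>_def by linarith
  finally show ?thesis unfolding a_def by simp
qed

lemma AE_infinite_crossing: "AE \<omega> in \<Omega>. infinite {e \<in> point_set (M \<omega>). crosses e 0}"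
proof -
  have le: "expectation (\<lambda>\<omega>. \<bar>crossing_sign 0 (M \<omega>)\<bar>) \<le> 0"
  proof (rule field_le_epsilon)
    fix \<epsilon> :: real assume "0 < \<epsilon>"
    then show "expectation (\<lambda>\<omega>. \<bar>crossing_sign 0 (M \<omega>)\<bar>) \<le> 0 + \<epsilon>"
      using expectation_crossing_sign_le[of "\<epsilon> / 3"] by simp
  qed
  then have "expectation (\<lambda>\<omega>. \<bar>crossing_sign 0 (M \<omega>)\<bar>) = 0"
    by (intro antisym integral_nonneg) auto
  then have "AE \<omega> in \<Omega>. \<bar>crossing_sign 0 (M \<omega>)\<bar> = 0"
    by (subst (asm) integral_nonneg_eq_0_iff_AE) (auto intro!: integrable_bounded[where B = 1] simp: abs_crossing_sign_le)
  then show ?thesis using AE_matching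
  proof eventually_elim
    case (elim \<omega>)
    have inf: "infinite (point_set (M \<omega>) \<inter> crossing 0)"
      using elim(1) unfolding matching_crossing_sign[OF elim(2)] by (auto split: if_splits)
    \<comment> \<open>The two notions of crossing differ only in edges that end at \<open>0\<close>, and these are finitely many.\<close>
    have "point_set (M \<omega>) \<inter> crossing 0 \<subseteq> {e \<in> point_set (M \<omega>). crosses e 0} \<union> (point_set (M \<omega>) \<inter> touching {- 1<..0})"
    proof
      fix e assume e: "e \<in> point_set (M \<omega>) \<inter> crossing 0"
      then obtain x y where xy: "e = Upair x y" "x \<le> 0" "0 < y" by (auto simp: crossing_def)
      show "e \<in> {e \<in> point_set (M \<omega>). crosses e 0} \<union> (point_set (M \<omega>) \<inter> touching {- 1<..0})"
      proof (cases "x = 0")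
        case True
        then show ?thesis using e xy(1) by simp
      next
        case False
        then have "crosses e 0" unfolding crosses_def using xy by (intro exI[of _ x] exI[of _ y]) auto
        then show ?thesis using e by simp
      qed
    qed
    then show ?case
      using inf matching_finite_touching[OF elim(2), of "- 1" 0] finite_subset by blast
  qed
qed

end

theorem proposition1p6:
  fixes \<Omega> :: "'w measure"
    and P \<xi> :: "'w \<Rightarrow> real measure"
    and M :: "'w \<Rightarrow> real uprod measure"
    and \<mu> :: "nat pmf"
  assumes "prob_space \<Omega>"
    and "poisson_process \<Omega> 1 P"
    and "0 \<notin> set_pmf \<mu>"
    and "\<exists>k \<in> set_pmf \<mu>. odd k"
    and "iid_marks \<Omega> P \<mu> \<xi>"
    and "factor_matching_scheme \<Omega> P \<xi> M"
  shows "AE \<omega> in \<Omega>. infinite {e \<in> point_set (M \<omega>). crosses e 0}"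
proof -
  interpret factor_matching \<Omega> P \<xi> \<mu> M
    using assms by (simp add: factor_matching_def marked_poisson_def marked_poisson_axioms_def factor_matching_axioms_def)
  show ?thesis by (rule AE_infinite_crossing)
qed

end
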